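(* Fix $\kappa>0$. For every $\varepsilon>0$, the Markov chain $(X_k)_{k\ge0}$, $X_k:=x^\varepsilon_{k\varepsilon}$, obtained by sampling the random ODE defined in the context, admits an invariant probability measure $\pi_\varepsilon$ on $\mathcal M$; that is, there is a Borel probability measure $\pi_\varepsilon$ with $\int_{\mathcal M}P_\varepsilon(x,A)\,\pi_\varepsilon(\mathrm dx)=\pi_\varepsilon(A)$ for all Borel $A\subseteq\mathcal M$, where $P_\varepsilon$ is the transition kernel of the chain.
   Context: **Geometry.** $\mathcal M$ is a smooth, connected, compact, orientable $n$-dimensional manifold without boundary, embedded in $\mathbb R^m$, and $\phi\in C^\infty(\mathcal M)$. $\mathcal F=\{f_1,\dots,f_r\}$ is a family of smooth vector fields on $\mathcal M$ with $\operatorname{span}_{\mathbb R}\{f_1(x),\dots,f_r(x)\}=T_x\mathcal M$ for all $x\in\mathcal M$. By this span condition there is a unique Riemannian metric on $\mathcal M$ such that $\operatorname{grad}\psi=\sum_{i=1}^r f_i(\psi)f_i$ for all $\psi\in C^\infty(\mathcal M)$; $\nabla$ is its Levi-Civita connection. **Random ODE.** Let $W=(W^1,\dots,W^{2r})$ be a standard $2r$-dimensional Wiener process, $W_0=0$ (canonical process on Wiener space). For $\varepsilon>0$, $k\in\{0,1,2,\dots\}$, $\ell\in\{1,\dots,2r\}$ let $w_k^\ell:=W^\ell_{(k+1)\varepsilon}-W^\ell_{k\varepsilon}$ and $w_k=(w_k^1,\dots,w_k^{2r})$. For $\kappa>0$ define $$U^1_\kappa(s):=s+\tfrac{1+\sqrt{2\pi^2\kappa+1}}{2\pi}\sin(2\pi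 s),\qquad U^2_\kappa(s):=s+\tfrac{1+\sqrt{2\pi^2\kappa+1}}{\pi}\sin^2(\pi s).$$ For $w\in\mathbb R^{2r}$, $i\in\{1,\dots,r\}$, $j\in\{1,2\}$ let $\iota_i^j(w):=j$ if $w^{2i-1}w^{2i}\ge0$ and $\iota_i^j(w):=3-j$ if $w^{2i-1}w^{2i}<0$. For $t\in[k\varepsilon,(k+1)\varepsilon)$ set $$B^{2i+j-2}_\varepsilon(t,W):=W^{2i+j-2}_{k\varepsilon}+w_k^{2i+j-2}\,U_\kappa^{\iota_i^j(w_k)}\big(\tfrac{t-k\varepsilon}{\varepsilon}\big),$$ and let $b^\ell_\varepsilon:=\dot B^\ell_\varepsilon$ be its (piecewise continuous) time derivative. With $F_1=\cos$, $F_2=-\sin$ and $\bar f_0:=-\frac{1}{2\kappa}\sum_{i=1}^r\nabla_{f_i}f_i$, let $x^\varepsilon_t(x_0)$ denote the (continuous, piecewise smooth, globally defined) solution on $\mathcal M$ with $x^\varepsilon_0(x_0)=x_0$ of $$\dot x=\bar f_0(x)+\frac{1}{\sqrt\kappa}\sum_{i=1}^r\sum_{j=1}^2F_j(\phi(x))\,f_i(x)\,b^{2i+j-2}_\varepsilon(t,W).$$ **Sampled chain.** $X_k:=x^\varepsilon_{k\varepsilon}$ is a time-homogeneous Markov chain on $\mathcal M$ with transition kernel $P_\varepsilon(x,A):=\mathbb P\{x^\varepsilon_{\varepsilon}(x)\in A\}$ for Borel $A\subseteq\mathcal M$. *)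

theory Defs
  imports "HOL-Probability.Probability"
begin

section \<open>Smooth maps and embedded submanifolds\<close>

(* Meant for open S; there, in finite dimension, it is the usual class C^k. *)
primrec Ck_on ::
  "nat \<Rightarrow> 'a::real_normed_vector set \<Rightarrow> ('a \<Rightarrow> 'b::real_normed_vector) \<Rightarrow> bool" where
  "Ck_on 0 S f \<longleftrightarrow> continuous_on S f"
| "Ck_on (Suc k) S f \<longleftrightarrow>
     (\<forall>x\<in>S. f differentiable (at x)) \<and>
     (\<forall>v. Ck_on k S (\<lambda>x. frechet_derivative f (at x) v))"

definition smooth_on ::
  "'a::real_normed_vector set \<Rightarrow> ('a \<Rightarrow> 'b::real_normed_vector) \<Rightarrow> bool" where
  "smooth_on S f \<longleftrightarrow> (\<forall>k. Ck_on k S f)"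

(* Slice charts: around each point, a diffeomorphism h (with inverse h') of open sets of the
   ambient space straightens M to an n-dimensional linear subspace E. *)
definition embedded_submanifold :: "nat \<Rightarrow> 'a::euclidean_space set \<Rightarrow> bool" where
  "embedded_submanifold n M \<longleftrightarrow>
     (\<forall>p\<in>M. \<exists>U V E. \<exists>h h' :: 'a \<Rightarrow> 'a.
        open U \<and> open V \<and> p \<in> U \<and>
        homeomorphism U V h h' \<and> smooth_on U h \<and> smooth_on V h' \<and>
        subspace E \<and> dim E = n \<and> h ` (U \<inter> M) = V \<inter> E)"

(* Functions on M are represented by functions on the ambient space whose values off M are
   irrelevant; smoothness on M is local extendability to a smooth function. *)
definition smooth_map ::
  "'a::euclidean_space set \<Rightarrow> ('a \<Rightarrow> 'b::real_normed_vector) \<Rightarrow> bool" where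
  "smooth_map M \<psi> \<longleftrightarrow>
     (\<forall>p\<in>M. \<exists>U \<psi>'. open U \<and> p \<in> U \<and> smooth_on U \<psi>' \<and> (\<forall>y\<in>U \<inter> M. \<psi> y = \<psi>' y))"

definition curve_at :: "'a::euclidean_space set \<Rightarrow> 'a \<Rightarrow> 'a \<Rightarrow> (real \<Rightarrow> 'a) \<Rightarrow> bool" where
  "curve_at M x v \<gamma> \<longleftrightarrow>
     (\<exists>\<delta>>0. smooth_on {-\<delta><..<\<delta>} \<gamma> \<and> \<gamma> ` {-\<delta><..<\<delta>} \<subseteq> M) \<and>
     \<gamma> 0 = x \<and> (\<gamma> has_vector_derivative v) (at 0)"

definition tangent_space :: "'a::euclidean_space set \<Rightarrow> 'a \<Rightarrow> 'a set" where
  "tangent_space M x = {v. \<exists>\<gamma>. curve_at M x v \<gamma>}"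

(* The differential of \<psi> at x, applied to a tangent vector v. *)
definition tangent_deriv ::
  "'a::euclidean_space set \<Rightarrow> ('a \<Rightarrow> real) \<Rightarrow> 'a \<Rightarrow> 'a \<Rightarrow> real" where
  "tangent_deriv M \<psi> x v =
     (THE d. \<exists>\<gamma>. curve_at M x v \<gamma> \<and> ((\<lambda>t. \<psi> (\<gamma> t)) has_real_derivative d) (at 0))"

definition smooth_vector_field ::
  "'a::euclidean_space set \<Rightarrow> ('a \<Rightarrow> 'a) \<Rightarrow> bool" where
  "smooth_vector_field M X \<longleftrightarrow> smooth_map M X \<and> (\<forall>x\<in>M. X x \<in> tangent_space M x)"

(* X(\<psi>), the vector field X acting on \<psi> as a derivation. *)
definition vf_apply ::
  "'a::euclidean_space set \<Rightarrow> ('a \<Rightarrow> 'a) \<Rightarrow> ('a \<Rightarrow> real) \<Rightarrow> 'a \<Rightarrow> real" where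
  "vf_apply M X \<psi> = (\<lambda>x. tangent_deriv M \<psi> x (X x))"


section \<open>Orientability\<close>

definition tangent_basis ::
  "nat \<Rightarrow> 'a::euclidean_space set \<Rightarrow> 'a \<Rightarrow> (nat \<Rightarrow> 'a) \<Rightarrow> bool" where
  "tangent_basis n M x e \<longleftrightarrow>
     inj_on e {..<n} \<and> independent (e ` {..<n}) \<and> span (e ` {..<n}) = tangent_space M x"

(* The Leibniz formula, because n is not a type. *)
definition leibniz_det :: "nat \<Rightarrow> (nat \<Rightarrow> nat \<Rightarrow> real) \<Rightarrow> real" where
  "leibniz_det n A = (\<Sum>p | p permutes {..<n}. of_int (sign p) * (\<Prod>i<n. A i (p i)))"

definition same_orientation ::
  "nat \<Rightarrow> (nat \<Rightarrow> 'a::real_vector) \<Rightarrow> (nat \<Rightarrow> 'a) \<Rightarrow> bool" where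
  "same_orientation n e e' \<longleftrightarrow>
     (\<exists>A. (\<forall>j<n. e' j = (\<Sum>i<n. A i j *\<^sub>R e i)) \<and> leibniz_det n A > 0)"

(* A choice of an orientation class of ordered bases in each tangent space that is continuous,
   i.e. represented near each point by a continuous local frame. *)
definition orientation_of ::
  "nat \<Rightarrow> 'a::euclidean_space set \<Rightarrow> ('a \<Rightarrow> (nat \<Rightarrow> 'a) set) \<Rightarrow> bool" where
  "orientation_of n M \<Theta> \<longleftrightarrow>
     (\<forall>x\<in>M. \<exists>e. tangent_basis n M x e \<and>
        \<Theta> x = {e'. tangent_basis n M x e' \<and> same_orientation n e e'}) \<and>
     (\<forall>p\<in>M. \<exists>U E. open U \<and> p \<in> U \<and>
        (\<forall>i<n. continuous_on (U \<inter> M) (E i)) \<and>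
        (\<forall>x\<in>U \<inter> M. (\<lambda>i. E i x) \<in> \<Theta> x))"

definition orientable :: "nat \<Rightarrow> 'a::euclidean_space set \<Rightarrow> bool" where
  "orientable n M \<longleftrightarrow> (\<exists>\<Theta>. orientation_of n M \<Theta>)"


section \<open>Riemannian metrics and the Levi-Civita connection\<close>

definition riemannian_metric ::
  "'a::euclidean_space set \<Rightarrow> ('a \<Rightarrow> 'a \<Rightarrow> 'a \<Rightarrow> real) \<Rightarrow> bool" where
  "riemannian_metric M g \<longleftrightarrow>
     (\<forall>x\<in>M. \<forall>u\<in>tangent_space M x. \<forall>v\<in>tangent_space M x. \<forall>w\<in>tangent_space M x. \<forall>a b.
        g x u v = g x v u \<and>
        g x (a *\<^sub>R u + b *\<^sub>R v) w = a * g x u w + b * g x v w) \<and>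
     (\<forall>x\<in>M. \<forall>u\<in>tangent_space M x. u \<noteq> 0 \<longrightarrow> g x u u > 0) \<and>
     (\<forall>X Y. smooth_vector_field M X \<longrightarrow> smooth_vector_field M Y \<longrightarrow>
        smooth_map M (\<lambda>x. g x (X x) (Y x)))"

definition is_gradient ::
  "'a::euclidean_space set \<Rightarrow> ('a \<Rightarrow> 'a \<Rightarrow> 'a \<Rightarrow> real) \<Rightarrow> ('a \<Rightarrow> real) \<Rightarrow> ('a \<Rightarrow> 'a) \<Rightarrow> bool" where
  "is_gradient M g \<psi> G \<longleftrightarrow>
     smooth_vector_field M G \<and>
     (\<forall>x\<in>M. \<forall>v\<in>tangent_space M x. g x (G x) v = tangent_deriv M \<psi> x v)"

definition affine_connection ::
  "'a::euclidean_space set \<Rightarrow> (('a \<Rightarrow> 'a) \<Rightarrow> ('a \<Rightarrow> 'a) \<Rightarrow> 'a \<Rightarrow> 'a) \<Rightarrow> bool" where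
  "affine_connection M D \<longleftrightarrow>
     (\<forall>X Y. smooth_vector_field M X \<longrightarrow> smooth_vector_field M Y \<longrightarrow>
        smooth_vector_field M (D X Y)) \<and>
     (\<forall>X X' Y. smooth_vector_field M X \<longrightarrow> smooth_vector_field M X' \<longrightarrow>
        smooth_vector_field M Y \<longrightarrow>
        (\<forall>x\<in>M. D (\<lambda>y. X y + X' y) Y x = D X Y x + D X' Y x)) \<and>
     (\<forall>h X Y. smooth_map M h \<longrightarrow> smooth_vector_field M X \<longrightarrow> smooth_vector_field M Y \<longrightarrow>
        (\<forall>x\<in>M. D (\<lambda>y. h y *\<^sub>R X y) Y x = h x *\<^sub>R D X Y x)) \<and>
     (\<forall>X Y Y'. smooth_vector_field M X \<longrightarrow> smooth_vector_field M Y \<longrightarrow>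
        smooth_vector_field M Y' \<longrightarrow>
        (\<forall>x\<in>M. D X (\<lambda>y. Y y + Y' y) x = D X Y x + D X Y' x)) \<and>
     (\<forall>h X Y. smooth_map M h \<longrightarrow> smooth_vector_field M X \<longrightarrow> smooth_vector_field M Y \<longrightarrow>
        (\<forall>x\<in>M. D X (\<lambda>y. h y *\<^sub>R Y y) x = vf_apply M X h x *\<^sub>R Y x + h x *\<^sub>R D X Y x))"

(* The second conjunct is vanishing torsion, the bracket [X,Y] being the vector field that acts
   on functions as the commutator; the third is metric compatibility. *)
definition levi_civita ::
  "'a::euclidean_space set \<Rightarrow> ('a \<Rightarrow> 'a \<Rightarrow> 'a \<Rightarrow> real) \<Rightarrow>
   (('a \<Rightarrow> 'a) \<Rightarrow> ('a \<Rightarrow> 'a) \<Rightarrow> 'a \<Rightarrow> 'a) \<Rightarrow> bool" where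
  "levi_civita M g D \<longleftrightarrow>
     affine_connection M D \<and>
     (\<forall>X Y \<psi>. smooth_vector_field M X \<longrightarrow> smooth_vector_field M Y \<longrightarrow> smooth_map M \<psi> \<longrightarrow>
        (\<forall>x\<in>M. vf_apply M (\<lambda>y. D X Y y - D Y X y) \<psi> x =
                vf_apply M X (vf_apply M Y \<psi>) x - vf_apply M Y (vf_apply M X \<psi>) x)) \<and>
     (\<forall>X Y Z. smooth_vector_field M X \<longrightarrow> smooth_vector_field M Y \<longrightarrow>
        smooth_vector_field M Z \<longrightarrow>
        (\<forall>x\<in>M. vf_apply M X (\<lambda>y. g y (Y y) (Z y)) x =
                g x (D X Y x) (Z x) + g x (Y x) (D X Z x)))"


section \<open>The Wiener process and its piecewise smooth approximation\<close>

(* The last condition states joint independence over all coordinates and all increments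
   along a time grid, hence that the coordinates are independent as well. *)
definition wiener_process ::
  "nat \<Rightarrow> 'w measure \<Rightarrow> (nat \<Rightarrow> real \<Rightarrow> 'w \<Rightarrow> real) \<Rightarrow> bool" where
  "wiener_process d P W \<longleftrightarrow>
     prob_space P \<and>
     (\<forall>l\<in>{1..d}. \<forall>t\<ge>0. W l t \<in> borel_measurable P) \<and>
     (\<forall>l\<in>{1..d}. \<forall>\<omega>\<in>space P. W l 0 \<omega> = 0 \<and> continuous_on {0..} (\<lambda>t. W l t \<omega>)) \<and>
     (\<forall>l\<in>{1..d}. \<forall>s t. 0 \<le> s \<longrightarrow> s < t \<longrightarrow>
        distributed P lborel (\<lambda>\<omega>. W l t \<omega> - W l s \<omega>) (normal_density 0 (sqrt (t - s)))) \<and>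
     (\<forall>\<tau> N. 0 \<le> \<tau> 0 \<longrightarrow> strict_mono \<tau> \<longrightarrow>
        prob_space.indep_vars P (\<lambda>_. borel)
          (\<lambda>(l, k) \<omega>. W l (\<tau> (Suc k)) \<omega> - W l (\<tau> k) \<omega>) ({1..d} \<times> {..<N::nat}))"

text \<open>Below, \<open>w\<close> is a single path \<open>l \<mapsto> t \<mapsto> W l t \<omega>\<close>.\<close>

definition increment :: "real \<Rightarrow> (nat \<Rightarrow> real \<Rightarrow> real) \<Rightarrow> nat \<Rightarrow> nat \<Rightarrow> real" where
  "increment \<epsilon> w k l = w l (real (k + 1) * \<epsilon>) - w l (real k * \<epsilon>)"

definition U_fun :: "real \<Rightarrow> nat \<Rightarrow> real \<Rightarrow> real" where
  "U_fun \<kappa> j s =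
     (if j = 1
      then s + (1 + sqrt (2 * pi^2 * \<kappa> + 1)) / (2 * pi) * sin (2 * pi * s)
      else s + (1 + sqrt (2 * pi^2 * \<kappa> + 1)) / pi * (sin (pi * s))^2)"

definition iota :: "nat \<Rightarrow> nat \<Rightarrow> (nat \<Rightarrow> real) \<Rightarrow> nat" where
  "iota i j v = (if v (2 * i - 1) * v (2 * i) \<ge> 0 then j else 3 - j)"

(* B_approx \<kappa> \<epsilon> w i j is the component with index 2i+j-2, for i \<ge> 1 and j = 1, 2. *)
definition B_approx ::
  "real \<Rightarrow> real \<Rightarrow> (nat \<Rightarrow> real \<Rightarrow> real) \<Rightarrow> nat \<Rightarrow> nat \<Rightarrow> real \<Rightarrow> real" where
  "B_approx \<kappa> \<epsilon> w i j t =
     (let k = nat \<lfloor>t / \<epsilon>\<rfloor>; l = 2 * i + j - 2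
      in w l (real k * \<epsilon>) +
         increment \<epsilon> w k l * U_fun \<kappa> (iota i j (increment \<epsilon> w k)) ((t - real k * \<epsilon>) / \<epsilon>))"

(* The right derivative: B is smooth on each [k\<epsilon>, (k+1)\<epsilon>), so this is the ordinary
   derivative in the interior and fixes the value at the grid points k\<epsilon>. *)
definition b_approx ::
  "real \<Rightarrow> real \<Rightarrow> (nat \<Rightarrow> real \<Rightarrow> real) \<Rightarrow> nat \<Rightarrow> nat \<Rightarrow> real \<Rightarrow> real" where
  "b_approx \<kappa> \<epsilon> w i j t = vector_derivative (B_approx \<kappa> \<epsilon> w i j) (at_right t)"


section \<open>The random ODE and the kernel of the sampled chain\<close>

definition F_fun :: "nat \<Rightarrow> real \<Rightarrow> real" where
  "F_fun j y = (if j = 1 then cos y else - sin y)"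

definition drift ::
  "real \<Rightarrow> nat \<Rightarrow> (nat \<Rightarrow> 'a \<Rightarrow> 'a) \<Rightarrow> (('a \<Rightarrow> 'a) \<Rightarrow> ('a \<Rightarrow> 'a) \<Rightarrow> 'a \<Rightarrow> 'a) \<Rightarrow>
   'a \<Rightarrow> 'a::euclidean_space" where
  "drift \<kappa> r f D x = - (1 / (2 * \<kappa>)) *\<^sub>R (\<Sum>i = 1..r. D (f i) (f i) x)"

definition random_field ::
  "real \<Rightarrow> real \<Rightarrow> nat \<Rightarrow> (nat \<Rightarrow> 'a \<Rightarrow> 'a) \<Rightarrow> ('a \<Rightarrow> real) \<Rightarrow>
   (('a \<Rightarrow> 'a) \<Rightarrow> ('a \<Rightarrow> 'a) \<Rightarrow> 'a \<Rightarrow> 'a) \<Rightarrow> (nat \<Rightarrow> real \<Rightarrow> real) \<Rightarrow>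
   real \<Rightarrow> 'a \<Rightarrow> 'a::euclidean_space" where
  "random_field \<kappa> \<epsilon> r f \<phi> D w t x =
     drift \<kappa> r f D x +
     (1 / sqrt \<kappa>) *\<^sub>R
       (\<Sum>i = 1..r. \<Sum>j = 1..2. (F_fun j (\<phi> x) * b_approx \<kappa> \<epsilon> w i j t) *\<^sub>R f i x)"

definition piecewise_solution ::
  "'a::euclidean_space set \<Rightarrow> real \<Rightarrow> (real \<Rightarrow> 'a \<Rightarrow> 'a) \<Rightarrow> 'a \<Rightarrow> (real \<Rightarrow> 'a) \<Rightarrow> bool" where
  "piecewise_solution M \<epsilon> V x0 x \<longleftrightarrow>
     x 0 = x0 \<and> (\<forall>t\<ge>0. x t \<in> M) \<and> continuous_on {0..} x \<and>
     (\<forall>k::nat. \<forall>t\<in>{real k * \<epsilon>..<real (k + 1) * \<epsilon>}.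
        (x has_vector_derivative V t (x t)) (at t within {real k * \<epsilon>..<real (k + 1) * \<epsilon>}))"

(* x \<omega> x0 t is the state at time t of the trajectory started at x0. *)
definition sampled_kernel ::
  "'w measure \<Rightarrow> real \<Rightarrow> ('w \<Rightarrow> 'a \<Rightarrow> real \<Rightarrow> 'a) \<Rightarrow> 'a \<Rightarrow> 'a set \<Rightarrow> ennreal" where
  "sampled_kernel P \<epsilon> x x0 A = emeasure P {\<omega> \<in> space P. x \<omega> x0 \<epsilon> \<in> A}"

end

theory Submission
  imports Defs
begin

text \<open>
  All vector fields involved are Lipschitz on the compact set \<open>M\<close>, the drift because the Levi-Civita
  connection maps smooth fields to smooth fields. On the first cell the driving signal is an affine
  function of the Wiener increments once the signs in \<^term>\<open>iota\<close> are fixed. A Gronwall estimate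
  therefore makes the endpoint of a trajectory continuous in its starting point and, on each sign
  sector, in the increments; hence it is measurable and the kernel of the chain is Feller. The
  Krylov-Bogoliubov averaging argument then yields an invariant measure. The weak compactness it
  needs is reduced to Helly's selection theorem on the line through a Borel injection
  \<open>M \<rightarrow> [0,1]\<close> whose inverse extends continuously.
\<close>

subsection \<open>Weak compactness of probability measures on a compact set\<close>

text \<open>No measurability of the trajectories in the Wiener path is given: \<open>x\<close> is
  any choice of solutions, path by path. Measurability has to come from the stability estimate, by
  which the endpoint depends on the path only through the finitely many increments over the first
  cell. The obstacle is that \<open>iota\<close> jumps when a product of increments changes sign, so
  the estimate compares two paths only if their signs agree. The Feller property escapes this
  obstacle, since it compares two starting points under one and the same path; dominated convergence
  then averages over the paths. The detour through the line is asymmetric on purpose. Measures are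
  pushed forward along the code \<open>s\<close>, for which Borel measurability is enough, while
  test functions are pulled back along \<open>c\<close>, which must be continuous for weak
  convergence to apply. Continuity of both is out of reach in general: a circle has no continuous
  injection into the line.\<close>

lemma closed_indicator_approx:
  fixes C :: "'a::metric_space set"
  assumes "closed C"
  obtains f :: "nat \<Rightarrow> 'a \<Rightarrow> real"
  where "\<And>n. continuous_on UNIV (f n)" "\<And>n x. 0 \<le> f n x" "\<And>n x. f n x \<le> 1"
    "\<And>x. (\<lambda>n. f n x) \<longlonglongrightarrow> indicator C x"
proof (cases "C = {}")
  case True
  show ?thesis by (rule that[of "\<lambda>_ _. 0"]) (auto simp: True)
next
  case False
  define f where "f n x = max 0 (1 - real n * infdist x C)" for n x
  have "(\<lambda>n. f n x) \<longlonglongrightarrow> indicator C x" for x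
  proof (cases "x \<in> C")
    case True
    then show ?thesis by (simp add: f_def)
  next
    case notin: False
    then have pos: "infdist x C > 0"
      using in_closed_iff_infdist_zero[OF assms False] infdist_nonneg[of x C] by (metis less_eq_real_def)
    have "eventually (\<lambda>n. real n \<ge> 1 / infdist x C) sequentially"
      using filterlim_real_sequentially unfolding filterlim_at_top by blast
    then have "eventually (\<lambda>n. f n x = 0) sequentially"
      by eventually_elim (use pos in \<open>simp add: f_def field_simps\<close>)
    then show ?thesis
      using notin by (simp add: tendsto_eventually)
  qed
  moreover have "continuous_on UNIV (f n)" for n
    unfolding f_def by (intro continuous_intros)
  ultimately show ?thesis
    by (intro that[of f]) (auto simp: f_def infdist_nonneg)
qed

text \<open>Transfers information about integrals of bounded continuous functions to measures of
  closed sets. It serves both to identify two measures and to prove a kernel measurable.\<close>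

lemma integral_closed_approx:
  fixes N :: "'a::metric_space measure"
  assumes "prob_space N" "sets N = sets borel" "closed C"
    and f: "\<And>n. continuous_on UNIV (f n)" "\<And>n x. 0 \<le> f n x" "\<And>n x. f n x \<le> (1::real)"
      "\<And>x. (\<lambda>n. f n x) \<longlonglongrightarrow> indicator C x"
  shows "(\<lambda>n. \<integral>x. f n x \<partial>N) \<longlonglongrightarrow> measure N C"
proof -
  interpret prob_space N by fact
  have [measurable_cong]: "sets N = sets borel" by fact
  have [measurable]: "f n \<in> borel_measurable N" for n
    using borel_measurable_continuous_onI[OF f(1)] by simp
  have [measurable]: "C \<in> sets N" using assms by auto
  have "(\<lambda>n. \<integral>x. f n x \<partial>N) \<longlonglongrightarrow> (\<integral>x. indicator C x \<partial>N)"
    by (rule integral_dominated_convergence[where w = "\<lambda>_. 1"]) (auto simp: f)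
  then show ?thesis using \<open>C \<in> sets N\<close> sets.sets_into_space[OF \<open>C \<in> sets N\<close>] by (simp add: Int_absorb2)
qed

text \<open>Closed sets form an intersection-stable generator of the Borel sets, and their measures
  are limits of integrals of continuous functions with values in [0,1].\<close>

lemma prob_borel_eqI:
  fixes N N' :: "'a::metric_space measure"
  assumes N: "prob_space N" "sets N = sets borel" and N': "prob_space N'" "sets N' = sets borel"
    and eq: "\<And>f :: 'a \<Rightarrow> real. continuous_on UNIV f \<Longrightarrow> (\<And>x. \<bar>f x\<bar> \<le> 1) \<Longrightarrow> (\<integral>x. f x \<partial>N) = (\<integral>x. f x \<partial>N')"
  shows "N = N'"
proof (rule measure_eqI_generator_eq[where E = "Collect closed" and \<Omega> = UNIV and A = "\<lambda>_. UNIV"])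
  interpret N: prob_space N by fact
  interpret N': prob_space N' by fact
  fix C :: "'a set" assume "C \<in> Collect closed"
  then have "closed C" by simp
  obtain f :: "nat \<Rightarrow> 'a \<Rightarrow> real" where f: "\<And>n. continuous_on UNIV (f n)" "\<And>n x. 0 \<le> f n x"
    "\<And>n x. f n x \<le> 1" "\<And>x. (\<lambda>n. f n x) \<longlonglongrightarrow> indicator C x"
    using closed_indicator_approx[OF \<open>closed C\<close>] by blast
  have "(\<integral>x. f n x \<partial>N) = (\<integral>x. f n x \<partial>N')" for n
    using f(2,3)[of n] by (intro eq f(1)) (simp add: abs_le_iff order.trans[of _ 0])
  then have "measure N C = measure N' C"
    by (intro LIMSEQ_unique[OF integral_closed_approx[OF N \<open>closed C\<close> f]])
      (simp add: integral_closed_approx[OF N' \<open>closed C\<close> f])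
  then show "emeasure N C = emeasure N' C"
    by (simp add: N.emeasure_eq_measure N'.emeasure_eq_measure)
qed (use prob_space.finite_measure[OF N(1)] in
    \<open>auto simp: Int_stable_def assms borel_eq_closed finite_measure.emeasure_finite\<close>)

text \<open>At the first index \<open>m\<close> where the digits differ, the two series differ by
  \<open>2 / 3 ^ Suc m\<close>, and the tails beyond it can cancel at most half of that. The gap
  between the digits 0 and 2 is essential: in base 2 a leading 1 can be matched by a tail of ones,
  so close codes would not force equal digits.\<close>

lemma binary_code_bits:
  fixes b c :: "nat \<Rightarrow> bool"
  assumes "\<bar>(\<Sum>k. 2 * of_bool (b k) / 3 ^ Suc k) - (\<Sum>k. 2 * of_bool (c k) / 3 ^ Suc k)\<bar> < (1/3::real) ^ K"
    and "k < K"
  shows "b k = c k"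
proof (rule ccontr)
  assume "b k \<noteq> c k"
  define d where "d j = 2 * (of_bool (b j) - of_bool (c j)) / (3::real) ^ Suc j" for j
  have bd: "norm (d j) \<le> 2 / 3 * (1/3) ^ j" for j
    by (auto simp: d_def of_bool_def power_divide)
  have sm: "summable (\<lambda>j. 2 / 3 * (1/3::real) ^ j)" by (intro summable_mult summable_geometric) auto
  have sb: "summable (\<lambda>k. 2 * of_bool (b k) / (3::real) ^ Suc k)" for b :: "nat \<Rightarrow> bool"
    by (rule summable_comparison_test'[OF sm, of 0]) (auto simp: of_bool_def power_divide)
  have eq: "(\<Sum>k. 2 * of_bool (b k) / 3 ^ Suc k) - (\<Sum>k. 2 * of_bool (c k) / 3 ^ Suc k) = suminf d"
    unfolding d_def by (subst suminf_diff[OF sb sb]) (simp add: field_simps)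
  have sd: "summable d" by (rule summable_comparison_test'[OF sm, of 0]) (use bd in auto)
  define m where "m = (LEAST j. b j \<noteq> c j)"
  have m: "b m \<noteq> c m"
    using \<open>b k \<noteq> c k\<close> unfolding m_def by (rule LeastI)
  have min: "b j = c j" if "j < m" for j
    using not_less_Least[of j "\<lambda>j. b j \<noteq> c j"] that unfolding m_def by blast
  have "m \<le> k"
    using \<open>b k \<noteq> c k\<close> unfolding m_def by (rule Least_le)
  have "suminf d = (\<Sum>j. d (j + Suc m)) + (\<Sum>j<Suc m. d j)"
    by (rule suminf_split_initial_segment[OF sd])
  also have "(\<Sum>j<Suc m. d j) = d m"
    using min by (simp add: d_def)
  finally have split: "suminf d = (\<Sum>j. d (j + Suc m)) + d m" .
  have "(\<lambda>j. 2 / 3 * (1/3) ^ Suc m * (1/3::real) ^ j) sums (2 / 3 * (1/3) ^ Suc m * (1 / (1 - 1/3)))"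
    by (intro sums_mult geometric_sums) auto
  then have "(\<lambda>j. 2 / 3 * (1/3::real) ^ (j + Suc m)) sums (1/3) ^ Suc m"
    by (simp add: power_add field_simps)
  moreover have "norm (\<Sum>j. d (j + Suc m)) \<le> (\<Sum>j. 2 / 3 * (1/3::real) ^ (j + Suc m))"
    by (rule norm_suminf_le[OF bd sums_summable[OF calculation]])
  ultimately have tail: "\<bar>\<Sum>j. d (j + Suc m)\<bar> \<le> (1/3) ^ Suc m" by (simp add: sums_iff)
  have "\<bar>d m\<bar> = 2 * (1/3) ^ Suc m" using m by (auto simp: d_def power_divide)
  then have "\<bar>suminf d\<bar> \<ge> (1/3) ^ Suc m" using split tail by linarith
  moreover have "(1/3::real) ^ Suc m \<ge> (1/3) ^ K"
    using \<open>m \<le> k\<close> \<open>k < K\<close> by (intro power_decreasing) auto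
  ultimately show False using assms(1) eq by linarith
qed

text \<open>
  The code \<open>s x\<close> records in ternary digits 0 and 2 which members of a countable base contain \<open>x\<close>.
  On a compact set finitely many base members of small diameter form a cover, so a close code
  forces close points: the decoding map is uniformly continuous, although \<open>s\<close> is only Borel.
\<close>

lemma compact_real_coding:
  fixes M :: "'a::euclidean_space set"
  assumes "compact M"
  obtains s :: "'a \<Rightarrow> real" and c :: "real \<Rightarrow> 'a"
  where "s \<in> borel_measurable borel" "\<And>x. 0 \<le> s x" "\<And>x. s x \<le> 1"
    "continuous_on UNIV c" "\<And>x. x \<in> M \<Longrightarrow> c (s x) = x"
proof -
  obtain \<B> :: "'a set set" where "countable \<B>" and basis: "topological_basis \<B>"
    using ex_countable_basis by blast
  define B where "B = from_nat_into \<B>"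
  have "\<B> \<noteq> {}"
    using basis unfolding topological_basis_def by (metis Sup_empty UNIV_not_empty open_UNIV subset_empty)
  have opB: "open (B k)" for k
    using topological_basis_open[OF basis] from_nat_into[OF \<open>\<B> \<noteq> {}\<close>] by (simp add: B_def)
  define s where "s x = (\<Sum>k. 2 * of_bool (x \<in> B k) / (3::real) ^ Suc k)" for x
  have sums: "(\<lambda>k. 2 / (3::real) ^ Suc k) sums 1"
  proof -
    have "(\<lambda>k. 2 / 3 * (1/3::real) ^ k) sums (2 / 3 * (1 / (1 - 1/3)))"
      by (intro sums_mult geometric_sums) auto
    then show ?thesis by (simp add: power_divide)
  qed
  have summ: "summable (\<lambda>k. 2 * of_bool (x \<in> B k) / (3::real) ^ Suc k)" for x
    by (rule summable_comparison_test'[OF sums_summable[OF sums], of 0]) (auto simp: of_bool_def)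
  have s_nonneg: "0 \<le> s x" for x
    unfolding s_def by (intro suminf_nonneg summ) auto
  have s_le: "s x \<le> 1" for x
  proof -
    have "s x \<le> (\<Sum>k. 2 / (3::real) ^ Suc k)"
      unfolding s_def by (intro suminf_le summ sums_summable[OF sums]) (auto simp: of_bool_def)
    then show ?thesis using sums by (simp add: sums_iff)
  qed
  have s_meas: "s \<in> borel_measurable borel"
  proof -
    have [measurable]: "B k \<in> sets borel" for k using opB by simp
    have [measurable]: "(\<lambda>x. of_bool (x \<in> B k) :: real) \<in> borel_measurable borel" for k
      unfolding of_bool_def by measurable
    show ?thesis unfolding s_def by measurable
  qed
  have close: "\<exists>d>0. \<forall>x\<in>M. \<forall>y\<in>M. \<bar>s x - s y\<bar> < d \<longrightarrow> dist x y < e" if "e > 0" for e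
  proof -
    define I where "I = {k. \<forall>x\<in>B k. \<forall>y\<in>B k. dist x y < e}"
    have "M \<subseteq> (\<Union>k\<in>I. B k)"
    proof
      fix x assume "x \<in> M"
      obtain U where "U \<in> \<B>" "x \<in> U" "U \<subseteq> ball x (e/2)"
        using topological_basisE[OF basis open_ball, of x x "e/2"] \<open>e > 0\<close> by auto
      moreover obtain k where "U = B k"
        using from_nat_into_surj[OF \<open>countable \<B>\<close> \<open>U \<in> \<B>\<close>] unfolding B_def by metis
      moreover have "dist y z < e" if "y \<in> ball x (e/2)" "z \<in> ball x (e/2)" for y z
        using that dist_triangle_half_r[of x y e z] by auto
      ultimately have "x \<in> B k" "k \<in> I" unfolding I_def by blast+
      then show "x \<in> (\<Union>k\<in>I. B k)" by blast
    qed
    then obtain J where "J \<subseteq> I" "finite J" and cov: "M \<subseteq> (\<Union>k\<in>J. B k)"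
      using compactE_image[OF assms, of I B] opB by metis
    obtain K where K: "\<And>k. k \<in> J \<Longrightarrow> k < K"
      using \<open>finite J\<close> by (auto simp: finite_nat_set_iff_bounded)
    have "dist x y < e" if xy: "x \<in> M" "y \<in> M" "\<bar>s x - s y\<bar> < (1/3) ^ K" for x y
    proof -
      obtain k where k: "k \<in> J" "x \<in> B k" using cov xy(1) by blast
      have "(x \<in> B k) = (y \<in> B k)"
        by (rule binary_code_bits[OF _ K[OF k(1)]]) (use xy(3) in \<open>simp add: s_def\<close>)
      then show ?thesis using k \<open>J \<subseteq> I\<close> unfolding I_def by blast
    qed
    then show ?thesis by (intro exI[of _ "(1/3) ^ K"]) auto
  qed
  have inj: "inj_on s M"
  proof (rule inj_onI, rule ccontr)
    fix x y assume "x \<in> M" "y \<in> M" "s x = s y" "x \<noteq> y"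
    then show False using close[of "dist x y"] by (metis abs_0 diff_self dist_pos_lt less_irrefl)
  qed
  have "uniformly_continuous_on (s ` M) (the_inv_into M s)"
    unfolding uniformly_continuous_on_def
  proof (intro allI impI)
    fix e :: real assume "e > 0"
    from close[OF this] obtain d where "d > 0" "\<forall>x\<in>M. \<forall>y\<in>M. \<bar>s x - s y\<bar> < d \<longrightarrow> dist x y < e" by blast
    then show "\<exists>d>0. \<forall>x\<in>s ` M. \<forall>x'\<in>s ` M. dist x' x < d \<longrightarrow>
        dist (the_inv_into M s x') (the_inv_into M s x) < e"
      by (intro exI[of _ d]) (auto simp: the_inv_into_f_f[OF inj] dist_real_def)
  qed
  \<comment> \<open>The set of codes need not be closed. Uniform continuity carries the decoding map
    to the closure, and only from a closed set does the Dugundji theorem extend it to the whole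
    line.\<close>
  then obtain c0 where "uniformly_continuous_on (closure (s ` M)) c0"
    and c0: "\<And>t. t \<in> s ` M \<Longrightarrow> the_inv_into M s t = c0 t"
    using uniformly_continuous_on_extension_on_closure by metis
  then have "continuous_on (closure (s ` M)) c0"
    using uniformly_continuous_imp_continuous by blast
  then obtain c where "continuous_on UNIV c" "\<And>t. t \<in> closure (s ` M) \<Longrightarrow> c t = c0 t"
    using Dugundji[of UNIV UNIV "closure (s ` M)" c0] by auto
  moreover have "c (s x) = x" if "x \<in> M" for x
    using calculation(2)[of "s x"] c0[of "s x"] that closure_subset[of "s ` M"]
    by (auto simp: the_inv_into_f_f[OF inj])
  ultimately show ?thesis
    by (intro that[of s c] s_meas s_nonneg s_le)
qed

text \<open>The coded measures live on [0,1], so tightness is automatic. The weak limit on the line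
  is decoded by \<open>c\<close>; for a test function \<open>f\<close> the composite with
  \<open>c\<close> is again bounded and continuous, and \<open>c (s x) = x\<close> holds almost
  everywhere along the sequence.\<close>

lemma compact_prob_weakly_convergent_subsequence:
  fixes M :: "'a::euclidean_space set" and \<mu> :: "nat \<Rightarrow> 'a measure"
  assumes "compact M"
    and \<mu>: "\<And>n. prob_space (\<mu> n)" "\<And>n. sets (\<mu> n) = sets borel" "\<And>n. AE x in \<mu> n. x \<in> M"
  obtains r :: "nat \<Rightarrow> nat" and \<pi> :: "'a measure"
  where "strict_mono r" "prob_space \<pi>" "sets \<pi> = sets borel" "AE x in \<pi>. x \<in> M"
    "\<forall>f :: 'a \<Rightarrow> real. continuous_on UNIV f \<longrightarrow> (\<forall>x. \<bar>f x\<bar> \<le> 1) \<longrightarrow>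
       (\<lambda>n. \<integral>x. f x \<partial>\<mu> (r n)) \<longlonglongrightarrow> (\<integral>x. f x \<partial>\<pi>)"
proof -
  obtain s :: "'a \<Rightarrow> real" and c :: "real \<Rightarrow> 'a" where s[measurable]: "s \<in> borel_measurable borel"
    and s01: "\<And>x. 0 \<le> s x" "\<And>x. s x \<le> 1" and c: "continuous_on UNIV c" "\<And>x. x \<in> M \<Longrightarrow> c (s x) = x"
    using compact_real_coding[OF \<open>compact M\<close>] by blast
  have [measurable]: "c \<in> borel_measurable borel" using c(1) by (rule borel_measurable_continuous_onI)
  note [measurable_cong] = \<mu>(2)
  define \<nu> where "\<nu> n = distr (\<mu> n) borel s" for n
  have \<nu>: "real_distribution (\<nu> n)" for n
    unfolding \<nu>_def real_distribution_def real_distribution_axioms_def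
    by (auto intro!: prob_space.prob_space_distr \<mu>)
  \<comment> \<open>Tightness is phrased with intervals open on the left; the end -1 keeps the code
    0 inside.\<close>
  have "measure (\<nu> n) {-1<..1} = 1" for n
  proof -
    interpret prob_space "\<mu> n" by (rule \<mu>)
    have "-1 < s x" for x using s01(1)[of x] by linarith
    then have "s -` {-1<..1} = UNIV" using s01 by auto
    then show ?thesis
      using prob_space sets_eq_imp_space_eq[OF \<mu>(2)[of n]] by (simp add: \<nu>_def measure_distr)
  qed
  then have "tight \<nu>"
    unfolding tight_def using \<nu> by (intro conjI allI impI exI[of _ "-1::real"] exI[of _ "1::real"]) auto
  from tight_imp_convergent_subsubsequence[OF this, of id]
  obtain r \<nu>0 where r: "strict_mono r" and \<nu>0: "real_distribution \<nu>0"
    and conv: "weak_conv_m (\<lambda>n. \<nu> (r n)) \<nu>0"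
    by (auto simp: strict_mono_def o_def)
  interpret \<nu>0: real_distribution \<nu>0 by fact
  define \<pi> where "\<pi> = distr \<nu>0 borel c"
  have \<pi>: "prob_space \<pi>" "sets \<pi> = sets borel"
    by (auto simp: \<pi>_def intro!: \<nu>0.prob_space_distr)
  have lim: "(\<lambda>n. \<integral>x. f x \<partial>\<mu> (r n)) \<longlonglongrightarrow> (\<integral>x. f x \<partial>\<pi>)"
    if f: "continuous_on UNIV f" "\<And>x. \<bar>f x\<bar> \<le> 1" for f :: "'a \<Rightarrow> real"
  proof -
    have [measurable]: "f \<in> borel_measurable borel" using f(1) by (rule borel_measurable_continuous_onI)
    have cont: "isCont (\<lambda>t. f (c t)) t" for t
      using continuous_on_compose2[OF f(1) c(1)] by (simp add: continuous_on_eq_continuous_at)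
    have "(\<lambda>n. \<integral>t. f (c t) \<partial>\<nu> (r n)) \<longlonglongrightarrow> (\<integral>t. f (c t) \<partial>\<nu>0)"
      by (rule weak_conv_imp_integral_bdd_continuous_conv[OF \<nu> \<nu>0 conv cont, where B = 1]) (simp add: f)
    moreover have "(\<integral>t. f (c t) \<partial>\<nu> n) = (\<integral>x. f x \<partial>\<mu> n)" for n
    proof -
      have "AE x in \<mu> n. f (c (s x)) = f x" using \<mu>(3) by eventually_elim (simp add: c(2))
      then show ?thesis unfolding \<nu>_def by (subst integral_distr) (auto intro!: integral_cong_AE)
    qed
    moreover have "(\<integral>t. f (c t) \<partial>\<nu>0) = (\<integral>x. f x \<partial>\<pi>)"
      unfolding \<pi>_def by (subst integral_distr) auto
    ultimately show ?thesis by simp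
  qed
  have "AE x in \<pi>. x \<in> M"
  proof -
    interpret \<pi>: prob_space \<pi> by fact
    note [measurable_cong] = \<pi>(2)
    \<comment> \<open>Nothing so far locates the codes charged by the limit, so concentration on
      \<open>M\<close> is recovered from weak convergence itself, tested on the distance to
      \<open>M\<close>. The cap at 1 makes it an admissible test function.\<close>
    define h where "h x = min 1 (infdist x M)" for x
    have h01: "0 \<le> h x" "h x \<le> 1" for x by (auto simp: h_def infdist_nonneg)
    have hc: "continuous_on UNIV h" unfolding h_def by (intro continuous_intros)
    then have [measurable]: "h \<in> borel_measurable borel" by (rule borel_measurable_continuous_onI)
    have "AE x in \<mu> n. h x = 0" for n
      using \<mu>(3) by eventually_elim (simp add: h_def)
    then have "(\<integral>x. h x \<partial>\<mu> n) = (\<integral>x. 0 \<partial>\<mu> n)" for n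
      by (intro integral_cong_AE) auto
    then have "(\<integral>x. h x \<partial>\<pi>) = 0"
      using lim[OF hc] h01 by (simp add: LIMSEQ_const_iff)
    moreover have "integrable \<pi> h"
      by (rule \<pi>.integrable_const_bound[of _ 1]) (auto simp: h01)
    ultimately have "AE x in \<pi>. h x = 0"
      by (subst (asm) integral_nonneg_eq_0_iff_AE) (auto simp: h01)
    \<comment> \<open>The distance to the empty set is 0 by convention, so \<open>h\<close> detects
      membership in \<open>M\<close> only if \<open>M\<close> is nonempty.\<close>
    moreover have "M \<noteq> {}"
    proof
      assume "M = {}"
      then have "AE x in \<mu> 0. False" using \<mu>(3)[of 0] by simp
      then show False using prob_space.AE_False[OF \<mu>(1)] by blast
    qed
    then have "h x = 0 \<longleftrightarrow> x \<in> M" for x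
      using in_closed_iff_infdist_zero[OF compact_imp_closed[OF \<open>compact M\<close>]] by (auto simp: h_def min_def split: if_splits)
    ultimately show ?thesis by simp
  qed
  then show ?thesis using r \<pi> lim by (intro that) auto
qed

subsection \<open>Invariant measures of Feller kernels\<close>

text \<open>For closed \<open>C\<close>, the map taking \<open>p\<close> to the mass of
  \<open>C\<close> under \<open>K p\<close> is on \<open>M\<close> a pointwise limit of functions
  that the Feller property makes continuous, and closed sets generate the Borel sets.\<close>

lemma feller_kernel_measurable:
  fixes M :: "'a::euclidean_space set"
  assumes "compact M" "q \<in> M"
    and K: "\<And>p. p \<in> M \<Longrightarrow> prob_space (K p)" "\<And>p. p \<in> M \<Longrightarrow> sets (K p) = sets borel"
    and feller: "\<And>f :: 'a \<Rightarrow> real. continuous_on UNIV f \<Longrightarrow> (\<And>x. \<bar>f x\<bar> \<le> 1) \<Longrightarrow>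
      continuous_on M (\<lambda>p. \<integral>x. f x \<partial>K p)"
  shows "(\<lambda>p. if p \<in> M then K p else return borel q) \<in> borel \<rightarrow>\<^sub>M prob_algebra borel"
proof (rule measurable_prob_algebra_generated[where \<Omega> = UNIV and G = "Collect closed"])
  have [measurable]: "M \<in> sets borel" using \<open>compact M\<close> by (simp add: borel_compact)
  fix C :: "'a set" assume "C \<in> Collect closed"
  then have "closed C" by simp
  then have [measurable]: "C \<in> sets borel" by simp
  obtain f :: "nat \<Rightarrow> 'a \<Rightarrow> real" where f: "\<And>n. continuous_on UNIV (f n)" "\<And>n x. 0 \<le> f n x"
    "\<And>n x. f n x \<le> 1" "\<And>x. (\<lambda>n. f n x) \<longlonglongrightarrow> indicator C x"
    using closed_indicator_approx[OF \<open>closed C\<close>] by blast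
  have "\<bar>f n x\<bar> \<le> 1" for n x using f(2,3)[of n x] by simp
  then have "(\<lambda>p. \<integral>x. f n x \<partial>K p) \<in> borel_measurable (restrict_space borel M)" for n
    by (intro borel_measurable_continuous_on_restrict feller f)
  then have "(\<lambda>p. measure (K p) C) \<in> borel_measurable (restrict_space borel M)"
    by (rule borel_measurable_LIMSEQ_real[rotated])
      (auto simp: space_restrict_space intro!: integral_closed_approx[OF K \<open>closed C\<close> f])
  then have "(\<lambda>p. ennreal (measure (K p) C)) \<in> borel_measurable (restrict_space borel M)"
    by measurable
  then have "(\<lambda>p. emeasure (K p) C) \<in> borel_measurable (restrict_space borel M)"
    by (rule measurable_cong[THEN iffD1, rotated])
      (use K(1) in \<open>simp add: space_restrict_space finite_measure.emeasure_eq_measure prob_space.finite_measure\<close>)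
  then have "(\<lambda>p. if p \<in> M then emeasure (K p) C else emeasure (return borel q) C) \<in> borel_measurable borel"
    by (subst measurable_If_restrict_space_iff) auto
  then show "(\<lambda>p. emeasure (if p \<in> M then K p else return borel q) C) \<in> borel_measurable borel"
    by (simp add: if_distrib[of "\<lambda>N. emeasure N C"])
qed (auto simp: Int_stable_def borel_eq_closed K intro: prob_space_return)

text \<open>For the average of the iterates 0 to \<open>n\<close>, the invariance defect tested on
  \<open>f\<close> telescopes to two boundary terms divided by \<open>n + 1\<close>. The Feller
  property is what lets the defect pass to the weak limit: integrating \<open>f\<close> against the
  kernel must again give a continuous test function.\<close>

theorem krylov_bogoliubov_compact:
  fixes M :: "'a::euclidean_space set"
  assumes "compact M" "M \<noteq> {}"
    and K: "\<And>p. p \<in> M \<Longrightarrow> prob_space (K p)" "\<And>p. p \<in> M \<Longrightarrow> sets (K p) = sets borel"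
      "\<And>p. p \<in> M \<Longrightarrow> AE x in K p. x \<in> M"
    and feller: "\<And>f :: 'a \<Rightarrow> real. continuous_on UNIV f \<Longrightarrow> (\<And>x. \<bar>f x\<bar> \<le> 1) \<Longrightarrow>
      continuous_on M (\<lambda>p. \<integral>x. f x \<partial>K p)"
  obtains \<pi> where "prob_space \<pi>" "sets \<pi> = sets borel" "AE x in \<pi>. x \<in> M"
    "\<forall>A\<in>sets borel. (\<integral>\<^sup>+p. emeasure (K p) A * indicator M p \<partial>\<pi>) = emeasure \<pi> A"
proof -
  obtain q where "q \<in> M" using \<open>M \<noteq> {}\<close> by blast
  have [measurable]: "M \<in> sets borel" using \<open>compact M\<close> by (simp add: borel_compact)
  \<comment> \<open>Iterating needs a kernel on the whole space. Sending points off \<open>M\<close>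
    to some \<open>q\<close> in \<open>M\<close> keeps every measure produced by one step
    concentrated on \<open>M\<close>.\<close>
  define K' where "K' p = (if p \<in> M then K p else return borel q)" for p
  have K': "K' \<in> borel \<rightarrow>\<^sub>M prob_algebra borel"
    unfolding K'_def by (rule feller_kernel_measurable[OF \<open>compact M\<close> \<open>q \<in> M\<close> K(1,2) feller])
  have K'_sub: "K' \<in> borel \<rightarrow>\<^sub>M subprob_algebra borel" by (rule measurable_prob_algebraD[OF K'])
  have K'_AE: "AE x in K' p. x \<in> M" for p
  proof -
    have "AE x in return borel q. x \<in> M" by (subst AE_return) (use \<open>q \<in> M\<close> in auto)
    moreover have "K' p = K p \<and> p \<in> M \<or> K' p = return borel q" by (simp add: K'_def)
    ultimately show ?thesis using K(3) by metis
  qed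
  have step: "prob_space (N \<bind> K')" "sets (N \<bind> K') = sets borel" "AE x in N \<bind> K'. x \<in> M"
    "\<And>f :: 'a \<Rightarrow> real. f \<in> borel_measurable borel \<Longrightarrow> (\<And>x. \<bar>f x\<bar> \<le> 1) \<Longrightarrow>
       (\<integral>x. f x \<partial>(N \<bind> K')) = (\<integral>p. \<integral>x. f x \<partial>K' p \<partial>N)"
    if "prob_space N" "sets N = sets borel" for N
  proof -
    have N: "N \<in> space (prob_algebra borel)" using that by (simp add: space_prob_algebra)
    have sub: "K' \<in> N \<rightarrow>\<^sub>M subprob_algebra borel"
      using K'_sub by (simp add: measurable_cong_sets[OF that(2) refl])
    show "prob_space (N \<bind> K')" "sets (N \<bind> K') = sets borel"
      using prob_space_bind'[OF N K'] sets_bind'[OF N K'] .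
    show "AE x in N \<bind> K'. x \<in> M" by (subst AE_bind[OF sub]) (use K'_AE in auto)
    fix f :: "'a \<Rightarrow> real" assume f: "f \<in> borel_measurable borel" "\<And>x. \<bar>f x\<bar> \<le> 1"
    show "(\<integral>x. f x \<partial>(N \<bind> K')) = (\<integral>p. \<integral>x. f x \<partial>K' p \<partial>N)"
    proof (rule integral_bind[where B' = 1, OF f(1)])
      show "finite_measure N" using that(1) by (rule prob_space.finite_measure)
      show "AE x in N. emeasure (K' x) (space (K' x)) \<le> ennreal 1"
        using measurable_space[OF K'] by (auto simp: space_prob_algebra prob_space.emeasure_space_1)
    qed (use f sub in auto)
  qed
  define \<mu> where "\<mu> k = ((\<lambda>N. N \<bind> K') ^^ k) (return borel q)" for k
  have \<mu>: "prob_space (\<mu> k)" "sets (\<mu> k) = sets borel" "AE x in \<mu> k. x \<in> M" for k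
  proof -
    have "prob_space (\<mu> k) \<and> sets (\<mu> k) = sets borel \<and> (AE x in \<mu> k. x \<in> M)"
    proof (induction k)
      case 0
      have "AE x in return borel q. x \<in> M" by (subst AE_return) (use \<open>q \<in> M\<close> in auto)
      moreover have "\<mu> 0 = return borel q" by (simp add: \<mu>_def)
      ultimately show ?case by (metis UNIV_I prob_space_return sets_return space_borel)
    next
      case (Suc k)
      moreover have "\<mu> (Suc k) = \<mu> k \<bind> K'" by (simp add: \<mu>_def)
      ultimately show ?case using step[of "\<mu> k"] by metis
    qed
    then show "prob_space (\<mu> k)" "sets (\<mu> k) = sets borel" "AE x in \<mu> k. x \<in> M" by auto
  qed
  have \<mu>_Suc: "\<mu> (Suc k) = \<mu> k \<bind> K'" for k by (simp add: \<mu>_def)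
  \<comment> \<open>The average is written as a mixture over a uniform random index, so that it is a
    probability measure by the general facts about \<open>bind\<close>.\<close>
  define \<alpha> where "\<alpha> n = measure_pmf (pmf_of_set {..n}) \<bind> \<mu>" for n :: nat
  have \<mu>_meas: "\<mu> \<in> measure_pmf (pmf_of_set {..n}) \<rightarrow>\<^sub>M prob_algebra borel" for n :: nat
    using \<mu> by (simp add: measurable_pmf_measure1 space_prob_algebra)
  have \<alpha>: "prob_space (\<alpha> n)" "sets (\<alpha> n) = sets borel" "AE x in \<alpha> n. x \<in> M" for n
  proof -
    have N: "measure_pmf (pmf_of_set {..n}) \<in> space (prob_algebra (count_space UNIV))"
      by (simp add: space_prob_algebra measure_pmf.prob_space_axioms)
    have \<mu>': "\<mu> \<in> count_space UNIV \<rightarrow>\<^sub>M prob_algebra borel"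
      using \<mu> by (simp add: space_prob_algebra)
    show "prob_space (\<alpha> n)" "sets (\<alpha> n) = sets borel"
      unfolding \<alpha>_def using prob_space_bind'[OF N \<mu>'] sets_bind'[OF N \<mu>'] .
    show "AE x in \<alpha> n. x \<in> M"
      unfolding \<alpha>_def by (subst AE_bind[OF measurable_prob_algebraD[OF \<mu>_meas]]) (use \<mu>(3) in auto)
  qed
  have \<alpha>_integral: "(\<integral>x. f x \<partial>\<alpha> n) = (\<Sum>k\<le>n. \<integral>x. f x \<partial>\<mu> k) / (real n + 1)"
    if f: "f \<in> borel_measurable borel" "\<And>x. \<bar>f x\<bar> \<le> 1" for f :: "'a \<Rightarrow> real" and n
  proof -
    have "(\<integral>x. f x \<partial>\<alpha> n) = (\<integral>k. \<integral>x. f x \<partial>\<mu> k \<partial>measure_pmf (pmf_of_set {..n}))"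
      unfolding \<alpha>_def
    proof (rule integral_bind[where B' = 1, OF f(1)])
      show "AE k in measure_pmf (pmf_of_set {..n}). emeasure (\<mu> k) (space (\<mu> k)) \<le> ennreal 1"
        using \<mu>(1) by (simp add: prob_space.emeasure_space_1)
      show "finite_measure (measure_pmf (pmf_of_set {..n}))"
        by (rule measure_pmf.finite_measure_axioms)
    qed (use f(2) measurable_prob_algebraD[OF \<mu>_meas] in auto)
    then show ?thesis by (simp add: integral_pmf_of_set add.commute)
  qed
  obtain r \<pi> where r: "strict_mono r" and \<pi>: "prob_space \<pi>" "sets \<pi> = sets borel" "AE x in \<pi>. x \<in> M"
    and conv: "\<forall>f :: 'a \<Rightarrow> real. continuous_on UNIV f \<longrightarrow> (\<forall>x. \<bar>f x\<bar> \<le> 1) \<longrightarrow>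
       (\<lambda>n. \<integral>x. f x \<partial>\<alpha> (r n)) \<longlonglongrightarrow> (\<integral>x. f x \<partial>\<pi>)"
    by (rule compact_prob_weakly_convergent_subsequence[OF \<open>compact M\<close> \<alpha>])
  have "\<pi> \<bind> K' = \<pi>"
  proof (rule prob_borel_eqI[OF step(1,2)[OF \<pi>(1,2)] \<pi>(1,2)])
    fix f :: "'a \<Rightarrow> real" assume f: "continuous_on UNIV f" "\<And>x. \<bar>f x\<bar> \<le> 1"
    have fm: "f \<in> borel_measurable borel" using f(1) by (rule borel_measurable_continuous_onI)
    have bound: "\<bar>\<integral>x. f x \<partial>N\<bar> \<le> 1" if "prob_space N" for N
    proof -
      interpret prob_space N by fact
      have "norm (\<integral>x. f x \<partial>N) \<le> (\<integral>x. norm (f x) \<partial>N)" by (rule integral_norm_bound)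
      also have "\<dots> \<le> (\<integral>x. 1 \<partial>N)"
        by (rule integral_mono') (use f(2) in auto)
      finally show ?thesis by (simp add: prob_space)
    qed
    have "continuous_on M (\<lambda>p. \<integral>x. f x \<partial>K p)" by (rule feller[OF f])
    moreover have "closedin (top_of_set UNIV) M" using compact_imp_closed[OF \<open>compact M\<close>] by simp
    \<comment> \<open>Weak convergence is available for functions continuous on the whole space,
      whereas the integral against \<open>K p\<close> is continuous on \<open>M\<close> only. The
      Tietze extension keeps the bound 1.\<close>
    ultimately obtain G where G: "continuous_on UNIV G" "\<And>p. p \<in> M \<Longrightarrow> G p = (\<integral>x. f x \<partial>K p)"
        "\<And>p. \<bar>G p\<bar> \<le> 1"
      using Tietze[of M "\<lambda>p. \<integral>x. f x \<partial>K p" UNIV 1] bound[OF K(1)] by auto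
    have Gm: "G \<in> borel_measurable borel" using G(1) by (rule borel_measurable_continuous_onI)
    have G_int: "(\<integral>p. G p \<partial>N) = (\<integral>x. f x \<partial>(N \<bind> K'))"
      if N: "prob_space N" "sets N = sets borel" "AE x in N. x \<in> M" for N
    proof -
      have [measurable_cong]: "sets N = sets borel" by fact
      note Gm[measurable]
      have [measurable]: "(\<lambda>p. \<integral>x. f x \<partial>K' p) \<in> borel_measurable N"
        using measurable_compose[OF K'_sub integral_measurable_subprob_algebra[OF fm]] by simp
      have "AE p in N. G p = (\<integral>x. f x \<partial>K' p)"
        using N(3) by eventually_elim (simp add: G(2) K'_def)
      then have "(\<integral>p. G p \<partial>N) = (\<integral>p. \<integral>x. f x \<partial>K' p \<partial>N)"
        by (intro integral_cong_AE) auto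
      then show ?thesis using step(4)[OF N(1,2) fm f(2)] by simp
    qed
    define a where "a k = (\<integral>x. f x \<partial>\<mu> k)" for k
    have "(\<integral>p. G p \<partial>\<alpha> n) - (\<integral>x. f x \<partial>\<alpha> n) = (a (Suc n) - a 0) / (real n + 1)" for n
    proof -
      have "(\<integral>p. G p \<partial>\<alpha> n) = (\<Sum>k\<le>n. a (Suc k)) / (real n + 1)"
        using \<alpha>_integral[OF Gm G(3)] G_int[OF \<mu>] by (simp add: \<mu>_Suc a_def)
      moreover have "(\<integral>x. f x \<partial>\<alpha> n) = (\<Sum>k\<le>n. a k) / (real n + 1)"
        using \<alpha>_integral[OF fm f(2)] by (simp add: a_def)
      ultimately show ?thesis
        using sum_telescope[of a n]
        by (simp add: diff_divide_distrib[symmetric] sum_subtractf[symmetric])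
           (metis (no_types, lifting) minus_diff_eq sum.cong sum_negf)
    qed
    moreover have "(\<lambda>n. (a (Suc n) - a 0) / (real n + 1)) \<longlonglongrightarrow> 0"
    proof (rule Lim_null_comparison)
      show "(\<lambda>n. 2 / (real n + 1)) \<longlonglongrightarrow> 0" by real_asymp
      show "eventually (\<lambda>n. norm ((a (Suc n) - a 0) / (real n + 1)) \<le> 2 / (real n + 1)) sequentially"
      proof (intro always_eventually allI)
        fix n
        have "\<bar>a (Suc n)\<bar> \<le> 1" "\<bar>a 0\<bar> \<le> 1" using bound[OF \<mu>(1)] by (simp_all add: a_def)
        then have "\<bar>a (Suc n) - a 0\<bar> \<le> 2" by linarith
        then show "norm ((a (Suc n) - a 0) / (real n + 1)) \<le> 2 / (real n + 1)"
          by (simp add: divide_right_mono)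
      qed
    qed
    ultimately have "(\<lambda>n. (\<integral>p. G p \<partial>\<alpha> n) - (\<integral>x. f x \<partial>\<alpha> n)) \<longlonglongrightarrow> 0" by simp
    from LIMSEQ_subseq_LIMSEQ[OF this r]
    have "(\<lambda>n. (\<integral>p. G p \<partial>\<alpha> (r n)) - (\<integral>x. f x \<partial>\<alpha> (r n))) \<longlonglongrightarrow> 0" by (simp add: o_def)
    moreover have "(\<lambda>n. (\<integral>p. G p \<partial>\<alpha> (r n)) - (\<integral>x. f x \<partial>\<alpha> (r n))) \<longlonglongrightarrow> (\<integral>p. G p \<partial>\<pi>) - (\<integral>x. f x \<partial>\<pi>)"
      using conv f G by (intro tendsto_diff) auto
    ultimately have "(\<integral>p. G p \<partial>\<pi>) = (\<integral>x. f x \<partial>\<pi>)"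
      using LIMSEQ_unique by fastforce
    then show "(\<integral>x. f x \<partial>(\<pi> \<bind> K')) = (\<integral>x. f x \<partial>\<pi>)"
      using G_int[OF \<pi>] by simp
  qed
  have "(\<integral>\<^sup>+p. emeasure (K p) A * indicator M p \<partial>\<pi>) = emeasure \<pi> A" if "A \<in> sets borel" for A
  proof -
    have "emeasure \<pi> A = emeasure (\<pi> \<bind> K') A" using \<open>\<pi> \<bind> K' = \<pi>\<close> by simp
    also have "\<dots> = (\<integral>\<^sup>+p. emeasure (K' p) A \<partial>\<pi>)"
      using K'_sub that prob_space.not_empty[OF \<pi>(1)]
      by (intro emeasure_bind) (simp_all add: measurable_cong_sets[OF \<pi>(2) refl])
    also have "\<dots> = (\<integral>\<^sup>+p. emeasure (K p) A * indicator M p \<partial>\<pi>)"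
    proof (rule nn_integral_cong_AE)
      show "AE p in \<pi>. emeasure (K' p) A = emeasure (K p) A * indicator M p"
        using \<pi>(3) by eventually_elim (simp add: K'_def)
    qed
    finally show ?thesis by simp
  qed
  then show ?thesis using \<pi> by (intro that) auto
qed

subsection \<open>Stability of the random ODE\<close>

text \<open>The segment between two points of \<open>M\<close> usually leaves \<open>M\<close>, so
  the mean value inequality is applied to a local smooth extension on a convex ball. Compactness
  then turns the local constants into a global one.\<close>

lemma smooth_map_lipschitz:
  fixes \<psi> :: "'a::euclidean_space \<Rightarrow> 'b::real_normed_vector"
  assumes "smooth_map M \<psi>" "compact M"
  obtains L where "L-lipschitz_on M \<psi>"
proof -
  \<comment> \<open>The time parameter is a dummy: \<open>local_lipschitz\<close> concerns
    time-dependent maps, and the singleton {0} reduces it to a single map.\<close>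
  have "local_lipschitz {0::real} M (\<lambda>_. \<psi>)"
  proof (rule local_lipschitzI)
    fix t :: real and p assume "p \<in> M"
    then obtain U \<psi>' where U: "open U" "p \<in> U" "smooth_on U \<psi>'" and eq: "\<And>y. y \<in> U \<inter> M \<Longrightarrow> \<psi> y = \<psi>' y"
      using assms(1) unfolding smooth_map_def by metis
    have "Ck_on (Suc 0) U \<psi>'" using U(3) unfolding smooth_on_def by blast
    then have diff: "\<And>x. x \<in> U \<Longrightarrow> \<psi>' differentiable (at x)"
      and cont: "\<And>v. continuous_on U (\<lambda>x. frechet_derivative \<psi>' (at x) v)" by auto
    obtain e where "e > 0" and e: "cball p e \<subseteq> U"
      using U(1,2) open_contains_cball by blast
    \<comment> \<open>Summing over a basis bounds the operator norm by a function whose continuity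
      follows from that of the individual directional derivatives.\<close>
    define g where "g x = (\<Sum>b\<in>Basis. norm (frechet_derivative \<psi>' (at x) b))" for x
    have "continuous_on (cball p e) g"
      unfolding g_def by (intro continuous_intros continuous_on_subset[OF cont e])
    then obtain B where B: "\<And>x. x \<in> cball p e \<Longrightarrow> g x \<le> B"
      using continuous_attains_sup[of "cball p e" g] \<open>e > 0\<close>
      by (metis cball_eq_empty compact_cball less_le_not_le)
    have "0 \<le> g p" unfolding g_def by (intro sum_nonneg) auto
    then have "B \<ge> 0" using B[of p] \<open>e > 0\<close> by simp
    have "B-lipschitz_on (cball p e \<inter> M) \<psi>"
    proof (rule lipschitz_onI[OF _ \<open>B \<ge> 0\<close>])
      fix y z assume yz: "y \<in> cball p e \<inter> M" "z \<in> cball p e \<inter> M"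
      have "norm (\<psi>' y - \<psi>' z) \<le> B * norm (y - z)"
      proof (rule differentiable_bound[OF convex_cball[of p e]])
        fix x assume x: "x \<in> cball p e"
        have D: "(\<psi>' has_derivative frechet_derivative \<psi>' (at x)) (at x)"
          using diff x e by (simp add: frechet_derivative_works[symmetric] subset_iff)
        then show "(\<psi>' has_derivative frechet_derivative \<psi>' (at x)) (at x within cball p e)"
          by (rule has_derivative_at_withinI)
        show "onorm (frechet_derivative \<psi>' (at x)) \<le> B"
          using onorm_componentwise[OF has_derivative_bounded_linear[OF D]] B[OF x] by (simp add: g_def)
      qed (use yz in auto)
      then show "dist (\<psi> y) (\<psi> z) \<le> B * dist y z"
        using yz e eq by (simp add: dist_norm subset_iff)
    qed
    then show "\<exists>u>0. \<exists>L. \<forall>t\<in>cball t u \<inter> {0}. L-lipschitz_on (cball p u \<inter> M) \<psi>"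
      using \<open>e > 0\<close> by blast
  qed
  then obtain L where "\<And>t. t \<in> {0::real} \<Longrightarrow> L-lipschitz_on M \<psi>"
    by (rule local_lipschitz_compact_implies_lipschitz[OF _ \<open>compact M\<close> compact_sing[of 0]]) auto
  then show ?thesis using that by blast
qed

lemma lipschitz_on_compact_bounded:
  fixes u :: "'a::metric_space \<Rightarrow> 'b::real_normed_vector"
  assumes "L-lipschitz_on M u" "compact M"
  obtains B where "B \<ge> 0" "\<And>x. x \<in> M \<Longrightarrow> norm (u x) \<le> B"
proof -
  have "bounded (u ` M)"
    using assms by (intro compact_imp_bounded compact_continuous_image lipschitz_on_continuous_on)
  then obtain B where "B > 0" "\<And>x. x \<in> M \<Longrightarrow> norm (u x) \<le> B"
    unfolding bounded_pos by auto
  then show ?thesis using that[of B] by simp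
qed

lemma lipschitz_on_scaleR_compact:
  fixes a :: "'a::metric_space \<Rightarrow> real" and u :: "'a \<Rightarrow> 'b::real_normed_vector"
  assumes a: "La-lipschitz_on M a" and u: "Lu-lipschitz_on M u" and "compact M"
  obtains L where "L-lipschitz_on M (\<lambda>x. a x *\<^sub>R u x)"
proof -
  obtain A where A: "A \<ge> 0" "\<And>x. x \<in> M \<Longrightarrow> norm (a x) \<le> A"
    using lipschitz_on_compact_bounded[OF a \<open>compact M\<close>] by blast
  obtain B where B: "B \<ge> 0" "\<And>x. x \<in> M \<Longrightarrow> norm (u x) \<le> B"
    using lipschitz_on_compact_bounded[OF u \<open>compact M\<close>] by blast
  have nn: "0 \<le> La" "0 \<le> Lu" using lipschitz_on_nonneg a u by blast+
  have "(A * Lu + La * B)-lipschitz_on M (\<lambda>x. a x *\<^sub>R u x)"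
  proof (rule lipschitz_onI)
    fix x y assume xy: "x \<in> M" "y \<in> M"
    have "a x *\<^sub>R u x - a y *\<^sub>R u y = a x *\<^sub>R (u x - u y) + (a x - a y) *\<^sub>R u y"
      by (simp add: algebra_simps)
    then have "norm (a x *\<^sub>R u x - a y *\<^sub>R u y) \<le> \<bar>a x\<bar> * norm (u x - u y) + \<bar>a x - a y\<bar> * norm (u y)"
      by (metis norm_scaleR norm_triangle_ineq)
    also have "\<dots> \<le> A * (Lu * dist x y) + (La * dist x y) * B"
      using lipschitz_onD[OF a xy] lipschitz_onD[OF u xy] A(2)[OF xy(1)] B(2)[OF xy(2)] A(1) nn
      by (intro add_mono mult_mono) (auto simp: dist_norm dist_real_def)
    finally show "dist (a x *\<^sub>R u x) (a y *\<^sub>R u y) \<le> (A * Lu + La * B) * dist x y"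
      by (simp add: dist_norm algebra_simps)
  qed (use A B nn in auto)
  then show ?thesis by (rule that)
qed

lemma lipschitz_on_sum:
  fixes u :: "'i \<Rightarrow> 'a::metric_space \<Rightarrow> 'b::real_normed_vector"
  assumes "\<And>i. i \<in> I \<Longrightarrow> (L i)-lipschitz_on M (u i)"
  shows "(\<Sum>i\<in>I. L i)-lipschitz_on M (\<lambda>x. \<Sum>i\<in>I. u i x)"
  using assms
proof (induction I rule: infinite_finite_induct)
  case (insert i I)
  then show ?case by (simp add: lipschitz_on_add)
qed (auto intro: lipschitz_onI)

text \<open>The squared distance is used because the norm is not differentiable at 0. Estimating
  \<open>2 * \<delta> * norm u\<close> by \<open>\<delta>\<^sup>2 + (norm u)\<^sup>2\<close>
  produces the extra 1 in \<open>2 * L + 1\<close>. After discounting by the exponential, the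
  remaining error rate is at most \<open>\<delta>\<^sup>2\<close>, which gives the factor
  \<open>T\<close>.\<close>

lemma gronwall_distance:
  fixes y z :: "real \<Rightarrow> 'a::real_inner"
  assumes "T > 0" "L \<ge> 0" "\<delta> \<ge> 0"
    and cont: "continuous_on {0..T} y" "continuous_on {0..T} z"
    and der: "\<And>t. t \<in> {0<..<T} \<Longrightarrow> (y has_vector_derivative y' t) (at t)"
      "\<And>t. t \<in> {0<..<T} \<Longrightarrow> (z has_vector_derivative z' t) (at t)"
    and bound: "\<And>t. t \<in> {0<..<T} \<Longrightarrow> norm (y' t - z' t) \<le> L * norm (y t - z t) + \<delta>"
  shows "(norm (y T - z T))\<^sup>2 \<le> exp ((2 * L + 1) * T) * ((norm (y 0 - z 0))\<^sup>2 + \<delta>\<^sup>2 * T)"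
proof -
  define c where "c = 2 * L + 1"
  define u where "u t = y t - z t" for t
  define h where "h t = exp (- c * t) * (u t \<bullet> u t) - \<delta>\<^sup>2 * t" for t
  have "h T \<le> h 0"
  proof (rule DERIV_nonpos_imp_decreasing_open[of 0 T h])
    fix t assume t: "0 < t" "t < T"
    define u' where "u' = y' t - z' t"
    have du: "(u has_vector_derivative u') (at t)"
      unfolding u_def u'_def using der t by (intro has_vector_derivative_diff) auto
    have "((\<lambda>t. u t \<bullet> u t) has_real_derivative 2 * (u t \<bullet> u')) (at t)"
      using has_derivative_inner[OF du[unfolded has_vector_derivative_def] du[unfolded has_vector_derivative_def]]
      by (simp add: has_field_derivative_def inner_commute algebra_simps mult_commute_abs)
    then have dh: "(h has_real_derivative
        (exp (- c * t) * (- c) * (u t \<bullet> u t) + exp (- c * t) * (2 * (u t \<bullet> u')) - \<delta>\<^sup>2)) (at t)"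
      unfolding h_def by (auto intro!: derivative_eq_intros)
    have n: "norm u' \<le> L * norm (u t) + \<delta>" using bound[of t] t by (simp add: u'_def u_def)
    have "u t \<bullet> u' \<le> norm (u t) * norm u'" by (rule norm_cauchy_schwarz)
    also have "\<dots> \<le> norm (u t) * (L * norm (u t) + \<delta>)" using n by (intro mult_left_mono) auto
    finally have "2 * (u t \<bullet> u') - c * (u t \<bullet> u t) \<le> 2 * \<delta> * norm (u t) - (norm (u t))\<^sup>2"
      by (simp add: c_def power2_norm_eq_inner[symmetric] power2_eq_square algebra_simps)
    also have "\<dots> \<le> \<delta>\<^sup>2"
      using zero_le_power2[of "\<delta> - norm (u t)"] by (simp add: power2_diff)
    finally have "exp (- c * t) * (2 * (u t \<bullet> u') - c * (u t \<bullet> u t)) \<le> exp (- c * t) * \<delta>\<^sup>2"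
      by (intro mult_left_mono) auto
    also have "\<dots> \<le> 1 * \<delta>\<^sup>2"
    proof (rule mult_right_mono)
      have "0 \<le> c * t" using t \<open>L \<ge> 0\<close> by (auto simp: c_def intro!: mult_nonneg_nonneg)
      then show "exp (- c * t) \<le> 1" by simp
    qed simp
    finally have "exp (- c * t) * (- c) * (u t \<bullet> u t) + exp (- c * t) * (2 * (u t \<bullet> u')) - \<delta>\<^sup>2 \<le> 0"
      by (simp add: algebra_simps)
    with dh show "\<exists>d. (h has_real_derivative d) (at t) \<and> d \<le> 0" by blast
  next
    show "continuous_on {0..T} h"
      unfolding h_def u_def by (intro continuous_intros cont)
  qed (use \<open>T > 0\<close> in simp)
  then have "exp (- c * T) * (norm (u T))\<^sup>2 \<le> (norm (u 0))\<^sup>2 + \<delta>\<^sup>2 * T"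
    by (simp add: h_def power2_norm_eq_inner)
  then have "exp (c * T) * (exp (- c * T) * (norm (u T))\<^sup>2) \<le> exp (c * T) * ((norm (u 0))\<^sup>2 + \<delta>\<^sup>2 * T)"
    by (intro mult_left_mono) auto
  moreover have "exp (c * T) * (exp (- c * T) * (norm (u T))\<^sup>2) = (norm (u T))\<^sup>2"
    by (simp add: mult.assoc[symmetric] exp_add[symmetric])
  ultimately show ?thesis by (simp only: u_def c_def)
qed

text \<open>Two solutions are compared that share the controls \<open>\<gamma>\<close> but have
  amplitudes \<open>v\<close> and \<open>w\<close>. The difference of the fields is split so that
  the Lipschitz term carries only \<open>v\<close> and the amplitude difference meets only the bound
  \<open>B\<close>. Hence the exponential factor does not depend on \<open>w\<close>, and the
  estimate is continuous in \<open>w\<close> for fixed \<open>v\<close>.\<close>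

lemma controlled_ode_stability:
  fixes y z :: "real \<Rightarrow> 'a::euclidean_space" and F :: "'i \<Rightarrow> 'a \<Rightarrow> 'a"
  assumes "T > 0" "finite I" "C \<ge> 0" "B \<ge> 0"
    and a: "La-lipschitz_on M a" and F: "\<And>l. l \<in> I \<Longrightarrow> LF-lipschitz_on M (F l)"
    and LF: "LF \<ge> 0"
    and B: "\<And>l x. l \<in> I \<Longrightarrow> x \<in> M \<Longrightarrow> norm (F l x) \<le> B"
    and C: "\<And>l t. l \<in> I \<Longrightarrow> t \<in> {0<..<T} \<Longrightarrow> \<bar>\<gamma> l t\<bar> \<le> C"
    and cont: "continuous_on {0..T} y" "continuous_on {0..T} z"
    and M: "\<And>t. t \<ge> 0 \<Longrightarrow> y t \<in> M" "\<And>t. t \<ge> 0 \<Longrightarrow> z t \<in> M"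
    and y: "\<And>t. t \<in> {0<..<T} \<Longrightarrow>
      (y has_vector_derivative (a (y t) + (\<Sum>l\<in>I. (v l * \<gamma> l t) *\<^sub>R F l (y t)))) (at t)"
    and z: "\<And>t. t \<in> {0<..<T} \<Longrightarrow>
      (z has_vector_derivative (a (z t) + (\<Sum>l\<in>I. (w l * \<gamma> l t) *\<^sub>R F l (z t)))) (at t)"
  shows "(norm (y T - z T))\<^sup>2 \<le> exp ((2 * (La + (\<Sum>l\<in>I. \<bar>v l\<bar> * C * LF)) + 1) * T) *
    ((norm (y 0 - z 0))\<^sup>2 + (\<Sum>l\<in>I. \<bar>v l - w l\<bar> * C * B)\<^sup>2 * T)"
proof (rule gronwall_distance[OF \<open>T > 0\<close> _ _ cont y z])
  show "0 \<le> La + (\<Sum>l\<in>I. \<bar>v l\<bar> * C * LF)"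
    using lipschitz_on_nonneg[OF a] \<open>C \<ge> 0\<close> LF by (intro add_nonneg_nonneg sum_nonneg) auto
  show "0 \<le> (\<Sum>l\<in>I. \<bar>v l - w l\<bar> * C * B)"
    using \<open>C \<ge> 0\<close> \<open>B \<ge> 0\<close> by (intro sum_nonneg) auto
  fix t assume t: "t \<in> {0<..<T}"
  then have yz: "y t \<in> M" "z t \<in> M" using M by auto
  let ?p = "y t" and ?q = "z t"
  have term_bound: "norm ((v l * \<gamma> l t) *\<^sub>R F l ?p - (w l * \<gamma> l t) *\<^sub>R F l ?q)
      \<le> (\<bar>v l\<bar> * C * LF) * norm (?p - ?q) + \<bar>v l - w l\<bar> * C * B" if l: "l \<in> I" for l
  proof -
    have "(v l * \<gamma> l t) *\<^sub>R F l ?p - (w l * \<gamma> l t) *\<^sub>R F l ?q =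
        (v l * \<gamma> l t) *\<^sub>R (F l ?p - F l ?q) + ((v l - w l) * \<gamma> l t) *\<^sub>R F l ?q"
      by (simp add: algebra_simps)
    then have "norm ((v l * \<gamma> l t) *\<^sub>R F l ?p - (w l * \<gamma> l t) *\<^sub>R F l ?q) \<le>
        \<bar>v l\<bar> * \<bar>\<gamma> l t\<bar> * norm (F l ?p - F l ?q) + \<bar>v l - w l\<bar> * \<bar>\<gamma> l t\<bar> * norm (F l ?q)"
      by (metis abs_mult norm_scaleR norm_triangle_ineq)
    also have "\<dots> \<le> \<bar>v l\<bar> * C * (LF * norm (?p - ?q)) + \<bar>v l - w l\<bar> * C * B"
      using C[OF l t] B[OF l yz(2)] lipschitz_on_normD[OF F[OF l] yz] \<open>C \<ge> 0\<close>
      by (intro add_mono mult_mono) auto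
    finally show ?thesis by (simp add: algebra_simps)
  qed
  have "norm ((a ?p + (\<Sum>l\<in>I. (v l * \<gamma> l t) *\<^sub>R F l ?p)) - (a ?q + (\<Sum>l\<in>I. (w l * \<gamma> l t) *\<^sub>R F l ?q)))
      = norm ((a ?p - a ?q) + (\<Sum>l\<in>I. (v l * \<gamma> l t) *\<^sub>R F l ?p - (w l * \<gamma> l t) *\<^sub>R F l ?q))"
    by (simp add: sum_subtractf add_diff_add)
  also have "\<dots> \<le> La * norm (?p - ?q) +
      (\<Sum>l\<in>I. (\<bar>v l\<bar> * C * LF) * norm (?p - ?q) + \<bar>v l - w l\<bar> * C * B)"
    by (intro order.trans[OF norm_triangle_ineq] add_mono lipschitz_on_normD[OF a yz]
        order.trans[OF norm_sum] sum_mono term_bound)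
  finally show "norm ((a ?p + (\<Sum>l\<in>I. (v l * \<gamma> l t) *\<^sub>R F l ?p)) - (a ?q + (\<Sum>l\<in>I. (w l * \<gamma> l t) *\<^sub>R F l ?q)))
      \<le> (La + (\<Sum>l\<in>I. \<bar>v l\<bar> * C * LF)) * norm (?p - ?q) + (\<Sum>l\<in>I. \<bar>v l - w l\<bar> * C * B)"
    by (simp add: sum.distrib sum_distrib_right distrib_right)
qed

definition U_deriv :: "real \<Rightarrow> nat \<Rightarrow> real \<Rightarrow> real" where
  "U_deriv \<kappa> j s =
     (if j = 1 then 1 + (1 + sqrt (2 * pi^2 * \<kappa> + 1)) * cos (2 * pi * s)
      else 1 + (1 + sqrt (2 * pi^2 * \<kappa> + 1)) * (2 * sin (pi * s) * cos (pi * s)))"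

lemma U_fun_has_derivative: "(U_fun \<kappa> j has_real_derivative U_deriv \<kappa> j s) (at s)"
proof (cases "j = 1")
  case True
  then have "U_fun \<kappa> j = (\<lambda>s. s + (1 + sqrt (2 * pi^2 * \<kappa> + 1)) / (2 * pi) * sin (2 * pi * s))"
    by (simp add: U_fun_def fun_eq_iff)
  then show ?thesis using True by (auto simp: U_deriv_def intro!: derivative_eq_intros)
next
  case False
  then have "U_fun \<kappa> j = (\<lambda>s. s + (1 + sqrt (2 * pi^2 * \<kappa> + 1)) / pi * (sin (pi * s))^2)"
    by (simp add: U_fun_def fun_eq_iff)
  then show ?thesis using False by (auto simp: U_deriv_def intro!: derivative_eq_intros)
qed

lemma U_deriv_bound: "\<bar>U_deriv \<kappa> j s\<bar> \<le> 1 + 2 * \<bar>1 + sqrt (2 * pi^2 * \<kappa> + 1)\<bar>"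
proof -
  let ?c = "1 + sqrt (2 * pi^2 * \<kappa> + 1)"
  \<comment> \<open>The bound 2 rather than 1 covers \<open>2 * sin (pi * s) * cos (pi * s)\<close>
    estimated factor by factor, without the double-angle formula.\<close>
  have aux: "\<bar>1 + ?c * b\<bar> \<le> 1 + 2 * \<bar>?c\<bar>" if "\<bar>b\<bar> \<le> 2" for b
  proof -
    have "\<bar>?c * b\<bar> \<le> \<bar>?c\<bar> * 2" using that unfolding abs_mult by (intro mult_left_mono) auto
    then show ?thesis using abs_triangle_ineq[of 1 "?c * b"] by linarith
  qed
  have "\<bar>sin (pi * s) * cos (pi * s)\<bar> \<le> 1 * 1"
    unfolding abs_mult by (intro mult_mono) auto
  then show ?thesis
    unfolding U_deriv_def using aux[of "cos (2 * pi * s)"] aux[of "2 * sin (pi * s) * cos (pi * s)"]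
      abs_cos_le_one[of "2 * pi * s"]
    by (auto simp: abs_mult simp del: abs_cos_le_one)
qed

text \<open>The kernel looks only at time \<open>\<epsilon>\<close>, so one cell suffices. Just to
  the right of \<open>t\<close> the floor is still 0 and \<open>B_approx\<close> coincides with one
  smooth expression, whose ordinary derivative therefore gives the right derivative.\<close>

lemma b_approx_first_cell:
  assumes "0 \<le> t" "t < \<epsilon>"
  shows "b_approx \<kappa> \<epsilon> w i j t = increment \<epsilon> w 0 (2 * i + j - 2) *
    (U_deriv \<kappa> (iota i j (increment \<epsilon> w 0)) (t / \<epsilon>) / \<epsilon>)"
proof -
  have "\<epsilon> > 0" using assms by simp
  let ?l = "2 * i + j - 2" and ?k = "iota i j (increment \<epsilon> w 0)"
  have eq: "B_approx \<kappa> \<epsilon> w i j s = w ?l 0 + increment \<epsilon> w 0 ?l * U_fun \<kappa> ?k (s / \<epsilon>)"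
    if "0 \<le> s" "s < \<epsilon>" for s
  proof -
    have "\<lfloor>s / \<epsilon>\<rfloor> = 0" using that \<open>\<epsilon> > 0\<close> by (simp add: floor_eq_iff)
    then show ?thesis by (simp add: B_approx_def Let_def)
  qed
  have "((\<lambda>s. U_fun \<kappa> ?k (s / \<epsilon>)) has_real_derivative U_deriv \<kappa> ?k (t / \<epsilon>) * (1 / \<epsilon>)) (at_right t)"
    by (rule DERIV_chain'[OF _ U_fun_has_derivative])
       (use \<open>\<epsilon> > 0\<close> in \<open>auto intro!: derivative_eq_intros\<close>)
  then have "((\<lambda>s. w ?l 0 + increment \<epsilon> w 0 ?l * U_fun \<kappa> ?k (s / \<epsilon>)) has_real_derivative
      increment \<epsilon> w 0 ?l * (U_deriv \<kappa> ?k (t / \<epsilon>) / \<epsilon>)) (at_right t)"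
    by (auto intro!: derivative_eq_intros)
  moreover have "eventually (\<lambda>s. B_approx \<kappa> \<epsilon> w i j s = w ?l 0 + increment \<epsilon> w 0 ?l * U_fun \<kappa> ?k (s / \<epsilon>)) (at_right t)"
    unfolding eventually_at_right_field using assms by (intro exI[of _ \<epsilon>]) (auto intro: eq)
  ultimately have "(B_approx \<kappa> \<epsilon> w i j has_real_derivative
      increment \<epsilon> w 0 ?l * (U_deriv \<kappa> ?k (t / \<epsilon>) / \<epsilon>)) (at_right t)"
    by (subst has_field_derivative_cong_eventually) (simp_all add: eq assms)
  then have "(B_approx \<kappa> \<epsilon> w i j has_vector_derivative
      increment \<epsilon> w 0 ?l * (U_deriv \<kappa> ?k (t / \<epsilon>) / \<epsilon>)) (at_right t)"
    by (simp add: has_real_derivative_iff_has_vector_derivative)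
  then show ?thesis
    unfolding b_approx_def by (intro vector_derivative_within) (auto simp: trivial_limit_at_right_real)
qed

text \<open>\<open>Z\<close> factors through \<open>v\<close> on \<open>A\<close> by a function continuous on \<open>v ` A\<close>, a set that need not be Borel.\<close>

lemma measurable_on_piece_if_determined:
  fixes Z :: "'w \<Rightarrow> 'a::metric_space" and v :: "'w \<Rightarrow> 'b::topological_space"
  assumes v: "v \<in> borel_measurable P" and "A \<subseteq> space P"
    and dist: "\<And>\<omega>. \<omega> \<in> A \<Longrightarrow> \<exists>g. continuous_on UNIV g \<and> g (v \<omega>) = 0 \<and>
      (\<forall>\<omega>'\<in>A. dist (Z \<omega>') (Z \<omega>) \<le> g (v \<omega>'))"
  shows "Z \<in> borel_measurable (restrict_space P A)"
proof -
  \<comment> \<open>The choice within a fibre of \<open>v\<close> is harmless: \<open>g\<close>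
    vanishes at \<open>v \<omega>\<close>, so \<open>Z\<close> is constant on each fibre inside
    \<open>A\<close>.\<close>
  define h where "h u = Z (SOME \<omega>. \<omega> \<in> A \<and> v \<omega> = u)" for u
  have h: "h (v \<omega>) = Z \<omega>" if "\<omega> \<in> A" for \<omega>
  proof -
    define \<omega>' where "\<omega>' = (SOME \<omega>'. \<omega>' \<in> A \<and> v \<omega>' = v \<omega>)"
    have "\<omega>' \<in> A \<and> v \<omega>' = v \<omega>" unfolding \<omega>'_def by (rule someI) (use that in simp)
    then have "dist (Z \<omega>') (Z \<omega>) \<le> 0" using dist[OF that] by metis
    then show ?thesis by (simp add: h_def \<omega>'_def)
  qed
  have "continuous_on (v ` A) h"
    unfolding continuous_on_def
  proof
    fix u assume "u \<in> v ` A"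
    then obtain \<omega> where \<omega>: "\<omega> \<in> A" "u = v \<omega>" by blast
    obtain g :: "'b \<Rightarrow> real" where g: "continuous_on UNIV g" "g u = 0" "\<And>\<omega>'. \<omega>' \<in> A \<Longrightarrow> dist (Z \<omega>') (Z \<omega>) \<le> g (v \<omega>')"
      using dist[OF \<omega>(1)] \<omega>(2) by blast
    have "(g \<longlongrightarrow> 0) (at u within v ` A)"
      using continuous_on_subset[OF g(1), of "v ` A"] \<open>u \<in> v ` A\<close> g(2)
      unfolding continuous_on_def by (metis subset_UNIV)
    moreover have "eventually (\<lambda>u'. dist (h u') (h u) \<le> g u') (at u within v ` A)"
      unfolding eventually_at_filter using g(3) by (intro always_eventually) (auto simp: h \<omega>)
    ultimately have "((\<lambda>u'. dist (h u') (h u)) \<longlongrightarrow> 0) (at u within v ` A)"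
      using tendsto_sandwich[of "\<lambda>_. 0" "\<lambda>u'. dist (h u') (h u)" _ g 0] by simp
    then show "(h \<longlongrightarrow> h u) (at u within v ` A)"
      using tendsto_dist_iff by blast
  qed
  then have "h \<in> borel_measurable (restrict_space borel (v ` A))"
    by (rule borel_measurable_continuous_on_restrict)
  moreover have "v \<in> restrict_space P A \<rightarrow>\<^sub>M restrict_space borel (v ` A)"
    by (rule measurable_restrict_space2)
       (use v in \<open>auto simp: space_restrict_space intro: measurable_restrict_space1\<close>)
  ultimately have "(\<lambda>\<omega>. h (v \<omega>)) \<in> borel_measurable (restrict_space P A)"
    by (rule measurable_compose[rotated])
  then show ?thesis
    by (rule measurable_cong[THEN iffD1, rotated]) (auto simp: space_restrict_space h)
qed

subsection \<open>The invariant measure of the sampled chain\<close>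

theorem proposition2:
  fixes M :: "'a::euclidean_space set"
    and n r :: nat
    and \<phi> :: "'a \<Rightarrow> real"
    and f :: "nat \<Rightarrow> 'a \<Rightarrow> 'a"
    and g :: "'a \<Rightarrow> 'a \<Rightarrow> 'a \<Rightarrow> real"
    and D :: "('a \<Rightarrow> 'a) \<Rightarrow> ('a \<Rightarrow> 'a) \<Rightarrow> 'a \<Rightarrow> 'a"
    and P :: "'w measure"
    and W :: "nat \<Rightarrow> real \<Rightarrow> 'w \<Rightarrow> real"
    and \<kappa> \<epsilon> :: real
    and x :: "'w \<Rightarrow> 'a \<Rightarrow> real \<Rightarrow> 'a"
  assumes "embedded_submanifold n M" and "M \<noteq> {}" and "connected M" and "compact M"
    and "orientable n M"
    and "smooth_map M \<phi>"
    and "\<And>i. i \<in> {1..r} \<Longrightarrow> smooth_vector_field M (f i)"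
    and "\<And>p. p \<in> M \<Longrightarrow> span ((\<lambda>i. f i p) ` {1..r}) = tangent_space M p"
    and "riemannian_metric M g"
    and "\<And>\<psi>. smooth_map M \<psi> \<Longrightarrow>
           is_gradient M g \<psi> (\<lambda>p. \<Sum>i = 1..r. vf_apply M (f i) \<psi> p *\<^sub>R f i p)"
    and "levi_civita M g D"
    and "wiener_process (2 * r) P W"
    and "\<kappa> > 0" and "\<epsilon> > 0"
    and "\<And>\<omega> x0. \<omega> \<in> space P \<Longrightarrow> x0 \<in> M \<Longrightarrow>
           piecewise_solution M \<epsilon> (random_field \<kappa> \<epsilon> r f \<phi> D (\<lambda>l t. W l t \<omega>)) x0 (x \<omega> x0)"
  shows "\<exists>\<pi>. prob_space \<pi> \<and> sets \<pi> = sets (restrict_space borel M) \<and>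
           (\<forall>A \<in> sets (restrict_space borel M).
              (\<integral>\<^sup>+ p. sampled_kernel P \<epsilon> x p A \<partial>\<pi>) = emeasure \<pi> A)"
proof -
  interpret P: prob_space P
    using \<open>wiener_process (2 * r) P W\<close> by (simp add: wiener_process_def)
  have W_meas: "W l t \<in> borel_measurable P" if "l \<in> {1..2 * r}" "t \<ge> 0" for l t
    using \<open>wiener_process (2 * r) P W\<close> that by (simp add: wiener_process_def)
  have solution: "x \<omega> p 0 = p" "\<And>t. t \<ge> 0 \<Longrightarrow> x \<omega> p t \<in> M" "continuous_on {0..\<epsilon>} (x \<omega> p)"
    "\<And>t. t \<in> {0<..<\<epsilon>} \<Longrightarrow> (x \<omega> p has_vector_derivative
        random_field \<kappa> \<epsilon> r f \<phi> D (\<lambda>l t. W l t \<omega>) t (x \<omega> p t)) (at t)"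
    if "\<omega> \<in> space P" "p \<in> M" for \<omega> p
  proof -
    have sol: "piecewise_solution M \<epsilon> (random_field \<kappa> \<epsilon> r f \<phi> D (\<lambda>l t. W l t \<omega>)) p (x \<omega> p)"
      using assms(15) that by blast
    then show "x \<omega> p 0 = p" "\<And>t. t \<ge> 0 \<Longrightarrow> x \<omega> p t \<in> M" "continuous_on {0..\<epsilon>} (x \<omega> p)"
      by (auto simp: piecewise_solution_def intro: continuous_on_subset)
    \<comment> \<open>In the open cell the derivative within the cell is the two-sided one. At the
      endpoints only continuity is kept, which is all that the Gronwall estimate asks for.\<close>
    fix t assume t: "t \<in> {0<..<\<epsilon>}"
    then have "(x \<omega> p has_vector_derivative
        random_field \<kappa> \<epsilon> r f \<phi> D (\<lambda>l t. W l t \<omega>) t (x \<omega> p t)) (at t within {0..<\<epsilon>})"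
      using sol[unfolded piecewise_solution_def, THEN conjunct2, THEN conjunct2, THEN conjunct2,
          rule_format, of t 0] by simp
    then show "(x \<omega> p has_vector_derivative
        random_field \<kappa> \<epsilon> r f \<phi> D (\<lambda>l t. W l t \<omega>) t (x \<omega> p t)) (at t)"
      using t by (simp add: at_within_interior[of t "{0..<\<epsilon>}"])
  qed

  \<comment> \<open>Uniform Lipschitz constants and bounds for the vector fields\<close>
  define I where "I = {1..r} \<times> {1..2::nat}"
  \<comment> \<open>Absorbing the trigonometric factor and \<open>1 / sqrt \<kappa>\<close> into the
    fields turns the double sum into one family of autonomous fields with scalar controls.\<close>
  define F where "F l = (\<lambda>p. (F_fun (snd l) (\<phi> p) / sqrt \<kappa>) *\<^sub>R f (fst l) p)" for l :: "nat \<times> nat"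
  have "finite I" by (simp add: I_def)
  obtain La where La: "La-lipschitz_on M (drift \<kappa> r f D)"
  proof -
    have "\<exists>L. L-lipschitz_on M (D (f i) (f i))" if "i \<in> {1..r}" for i
    proof -
      have "smooth_vector_field M (D (f i) (f i))"
        using \<open>levi_civita M g D\<close> assms(7)[OF that] by (simp add: levi_civita_def affine_connection_def)
      then show ?thesis
        using smooth_map_lipschitz[OF _ \<open>compact M\<close>] unfolding smooth_vector_field_def by metis
    qed
    then obtain L :: "nat \<Rightarrow> real" where "\<And>i. i \<in> {1..r} \<Longrightarrow> (L i)-lipschitz_on M (D (f i) (f i))" by metis
    then have "(\<Sum>i=1..r. L i)-lipschitz_on M (\<lambda>p. \<Sum>i=1..r. D (f i) (f i) p)"
      by (intro lipschitz_on_sum) auto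
    then have "(\<bar>- (1 / (2 * \<kappa>))\<bar> * (\<Sum>i=1..r. L i))-lipschitz_on M (drift \<kappa> r f D)"
      unfolding drift_def by (rule lipschitz_on_cmult)
    then show ?thesis by (rule that)
  qed
  have "\<exists>L. L-lipschitz_on M (F l)" if "l \<in> I" for l
  proof -
    have "smooth_map M (f (fst l))"
      using assms(7)[of "fst l"] that by (auto simp: I_def smooth_vector_field_def)
    then obtain Lf where Lf: "Lf-lipschitz_on M (f (fst l))"
      using smooth_map_lipschitz \<open>compact M\<close> by metis
    obtain Lp where Lp: "Lp-lipschitz_on M \<phi>"
      using smooth_map_lipschitz[OF \<open>smooth_map M \<phi>\<close> \<open>compact M\<close>] by blast
    have trig: "\<bar>F_fun j a - F_fun j b\<bar> \<le> \<bar>a - b\<bar>" for j a b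
    proof -
      have "norm (F_fun j a - F_fun j b) \<le> 1 * norm (a - b)"
        by (rule differentiable_bound[of UNIV _ "\<lambda>y h. (if j = 1 then - sin y else - cos y) * h"])
           (auto simp: F_fun_def[abs_def] abs_mult intro!: derivative_eq_intros onorm_bound mult_left_le_one_le)
      then show ?thesis by simp
    qed
    have "(Lp / sqrt \<kappa>)-lipschitz_on M (\<lambda>p. F_fun (snd l) (\<phi> p) / sqrt \<kappa>)"
    proof (rule lipschitz_onI)
      fix p q assume "p \<in> M" "q \<in> M"
      then have "\<bar>F_fun (snd l) (\<phi> p) - F_fun (snd l) (\<phi> q)\<bar> \<le> Lp * dist p q"
        using lipschitz_onD[OF Lp] trig[of "snd l" "\<phi> p" "\<phi> q"] by (fastforce simp: dist_real_def)
      then show "dist (F_fun (snd l) (\<phi> p) / sqrt \<kappa>) (F_fun (snd l) (\<phi> q) / sqrt \<kappa>) \<le> Lp / sqrt \<kappa> * dist p q"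
        using \<open>\<kappa> > 0\<close> by (simp add: dist_real_def diff_divide_distrib[symmetric] divide_right_mono)
    qed (use lipschitz_on_nonneg[OF Lp] \<open>\<kappa> > 0\<close> in auto)
    from lipschitz_on_scaleR_compact[OF this Lf \<open>compact M\<close>] show ?thesis
      unfolding F_def by metis
  qed
  then obtain L :: "nat \<times> nat \<Rightarrow> real" where L: "\<And>l. l \<in> I \<Longrightarrow> (L l)-lipschitz_on M (F l)" by metis
  have "\<exists>b\<ge>0. \<forall>p\<in>M. norm (F l p) \<le> b" if "l \<in> I" for l
    using lipschitz_on_compact_bounded[OF L[OF that] \<open>compact M\<close>] by metis
  then obtain b :: "nat \<times> nat \<Rightarrow> real" where b: "\<And>l. l \<in> I \<Longrightarrow> b l \<ge> 0" "\<And>l p. l \<in> I \<Longrightarrow> p \<in> M \<Longrightarrow> norm (F l p) \<le> b l"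
    by metis
  \<comment> \<open>A sum of nonnegative constants dominates each of them and, unlike a maximum,
    needs no care when the index set is empty.\<close>
  define LF where "LF = (\<Sum>l\<in>I. L l)"
  define B where "B = (\<Sum>l\<in>I. b l)"
  have L_nonneg: "0 \<le> L l" if "l \<in> I" for l using lipschitz_on_nonneg[OF L[OF that]] .
  have LF: "LF \<ge> 0" "\<And>l. l \<in> I \<Longrightarrow> LF-lipschitz_on M (F l)"
  proof -
    show "LF \<ge> 0" unfolding LF_def using L_nonneg by (rule sum_nonneg)
    fix l assume "l \<in> I"
    then show "LF-lipschitz_on M (F l)"
      unfolding LF_def using L_nonneg by (intro lipschitz_on_le[OF L] member_le_sum \<open>finite I\<close>) auto
  qed
  have B: "B \<ge> 0" "\<And>l p. l \<in> I \<Longrightarrow> p \<in> M \<Longrightarrow> norm (F l p) \<le> B"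
  proof -
    show "B \<ge> 0" unfolding B_def using b(1) by (rule sum_nonneg)
    fix l p assume "l \<in> I" "p \<in> M"
    then have "norm (F l p) \<le> b l" by (rule b(2))
    also have "b l \<le> B" unfolding B_def using b(1) \<open>l \<in> I\<close> by (intro member_le_sum \<open>finite I\<close>) auto
    finally show "norm (F l p) \<le> B" .
  qed

  \<comment> \<open>The driving signal on the first cell and the resulting stability
    estimate\<close>
  define incr where "incr \<omega> = increment \<epsilon> (\<lambda>l t. W l t \<omega>) 0" for \<omega>
  \<comment> \<open>The value 0 off \<open>I\<close> makes every coordinate measurable, as the
    product Borel structure on all index pairs demands; the Wiener coordinates are known to be
    measurable only for indices from 1 to \<open>2 * r\<close>.\<close>
  define v where "v \<omega> l = (if l \<in> I then incr \<omega> (2 * fst l + snd l - 2) else 0)" for \<omega> and l :: "nat \<times> nat"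
  \<comment> \<open>\<open>\<gamma>\<close> sees the path only through the signs in
    \<open>iota\<close>; the sizes of the increments sit in \<open>v\<close>. On a sign sector the
    control \<open>v * \<gamma>\<close> is thus linear in the increments.\<close>
  define \<gamma> where "\<gamma> \<omega> l t = U_deriv \<kappa> (iota (fst l) (snd l) (incr \<omega>)) (t / \<epsilon>) / \<epsilon>" for \<omega> l t
  define C where "C = (1 + 2 * \<bar>1 + sqrt (2 * pi^2 * \<kappa> + 1)\<bar>) / \<epsilon>"
  have C: "C \<ge> 0" "\<And>\<omega> l t. \<bar>\<gamma> \<omega> l t\<bar> \<le> C"
    using \<open>\<epsilon> > 0\<close> U_deriv_bound by (auto simp: C_def \<gamma>_def intro!: divide_right_mono)
  have field: "random_field \<kappa> \<epsilon> r f \<phi> D (\<lambda>l t. W l t \<omega>) t p =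
      drift \<kappa> r f D p + (\<Sum>l\<in>I. (v \<omega> l * \<gamma> \<omega> l t) *\<^sub>R F l p)" if "t \<in> {0<..<\<epsilon>}" for \<omega> t p
  proof -
    have "(1 / sqrt \<kappa>) *\<^sub>R (\<Sum>i = 1..r. \<Sum>j = 1..2.
        (F_fun j (\<phi> p) * b_approx \<kappa> \<epsilon> (\<lambda>l t. W l t \<omega>) i j t) *\<^sub>R f i p) =
      (\<Sum>l\<in>I. (1 / sqrt \<kappa> * (F_fun (snd l) (\<phi> p) * b_approx \<kappa> \<epsilon> (\<lambda>l t. W l t \<omega>) (fst l) (snd l) t)) *\<^sub>R f (fst l) p)"
      by (simp add: I_def sum.cartesian_product scaleR_sum_right split_beta)
    also have "\<dots> = (\<Sum>l\<in>I. (v \<omega> l * \<gamma> \<omega> l t) *\<^sub>R F l p)"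
      using that by (intro sum.cong) (auto simp: F_def v_def \<gamma>_def incr_def b_approx_first_cell mult_ac)
    finally show ?thesis by (simp add: random_field_def)
  qed
  have stability: "(norm (x \<omega> p \<epsilon> - x \<omega>' q \<epsilon>))\<^sup>2 \<le>
      exp ((2 * (La + (\<Sum>l\<in>I. \<bar>v \<omega> l\<bar> * C * LF)) + 1) * \<epsilon>) *
      ((norm (p - q))\<^sup>2 + (\<Sum>l\<in>I. \<bar>v \<omega> l - v \<omega>' l\<bar> * C * B)\<^sup>2 * \<epsilon>)"
    if "\<omega> \<in> space P" "\<omega>' \<in> space P" "p \<in> M" "q \<in> M"
      and same: "\<And>l. l \<in> I \<Longrightarrow> \<gamma> \<omega>' l = \<gamma> \<omega> l" for \<omega> \<omega>' p q
  proof -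
    note sol = solution[OF that(1,3)] and sol' = solution[OF that(2,4)]
    have "(norm (x \<omega> p \<epsilon> - x \<omega>' q \<epsilon>))\<^sup>2 \<le>
        exp ((2 * (La + (\<Sum>l\<in>I. \<bar>v \<omega> l\<bar> * C * LF)) + 1) * \<epsilon>) *
        ((norm (x \<omega> p 0 - x \<omega>' q 0))\<^sup>2 + (\<Sum>l\<in>I. \<bar>v \<omega> l - v \<omega>' l\<bar> * C * B)\<^sup>2 * \<epsilon>)"
    proof (rule controlled_ode_stability[OF \<open>\<epsilon> > 0\<close> \<open>finite I\<close> C(1) B(1) La LF(2,1) B(2) C(2)
          sol(3) sol'(3) sol(2) sol'(2)])
      fix t assume t: "t \<in> {0<..<\<epsilon>}"
      show "(x \<omega> p has_vector_derivative drift \<kappa> r f D (x \<omega> p t) +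
          (\<Sum>l\<in>I. (v \<omega> l * \<gamma> \<omega> l t) *\<^sub>R F l (x \<omega> p t))) (at t)"
        using sol(4)[OF t] field[OF t] by simp
      have "(\<Sum>l\<in>I. (v \<omega>' l * \<gamma> \<omega> l t) *\<^sub>R F l (x \<omega>' q t)) =
          (\<Sum>l\<in>I. (v \<omega>' l * \<gamma> \<omega>' l t) *\<^sub>R F l (x \<omega>' q t))"
        by (rule sum.cong) (simp_all add: same)
      then show "(x \<omega>' q has_vector_derivative drift \<kappa> r f D (x \<omega>' q t) +
          (\<Sum>l\<in>I. (v \<omega>' l * \<gamma> \<omega> l t) *\<^sub>R F l (x \<omega>' q t))) (at t)"
        using sol'(4)[OF t] field[OF t] by simp
    qed
    then show ?thesis by (simp add: sol(1) sol'(1))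
  qed

  \<comment> \<open>Measurability and continuity of the endpoint\<close>
  have incr_meas: "(\<lambda>\<omega>. incr \<omega> l) \<in> borel_measurable P" if "l \<in> {1..2 * r}" for l
    using W_meas[OF that, of 0] W_meas[OF that, of \<epsilon>] \<open>\<epsilon> > 0\<close> by (simp add: incr_def increment_def)
  have v_meas: "v \<in> borel_measurable P"
  proof (rule measurable_coordinatewise_then_product)
    fix l :: "nat \<times> nat"
    show "(\<lambda>\<omega>. v \<omega> l) \<in> borel_measurable P"
      unfolding v_def by (cases "l \<in> I") (auto simp: I_def intro!: incr_meas)
  qed
  have Z_meas: "(\<lambda>\<omega>. x \<omega> p \<epsilon>) \<in> borel_measurable P" if "p \<in> M" for p
  proof -
    \<comment> \<open>\<^term>\<open>iota\<close> jumps where a product of increments changes sign, so the endpoint depends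
      continuously on the increments only on each of finitely many sign sectors.\<close>
    define piece where "piece S = {\<omega> \<in> space P. \<forall>i\<in>{1..r}. incr \<omega> (2 * i - 1) * incr \<omega> (2 * i) \<ge> 0 \<longleftrightarrow> i \<in> S}" for S
    have piece_sets: "piece S \<in> sets P" for S
    proof -
      have "{\<omega> \<in> space P. 0 \<le> incr \<omega> (2 * i - 1) * incr \<omega> (2 * i) \<longleftrightarrow> i \<in> S} \<in> sets P"
        if "i \<in> {1..r}" for i
      proof -
        have [measurable]: "(\<lambda>\<omega>. incr \<omega> (2 * i - 1)) \<in> borel_measurable P" "(\<lambda>\<omega>. incr \<omega> (2 * i)) \<in> borel_measurable P"
          using that by (auto intro!: incr_meas)
        show ?thesis by measurable
      qed
      then show ?thesis
        unfolding piece_def by (rule sets.sets_Collect_finite_All) auto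
    qed
    show ?thesis
    proof (rule measurable_piecewise_restrict[where C = "piece ` Pow {1..r}"])
      show "space P \<subseteq> \<Union> (piece ` Pow {1..r})"
      proof
        fix \<omega> assume "\<omega> \<in> space P"
        then have "\<omega> \<in> piece {i\<in>{1..r}. incr \<omega> (2 * i - 1) * incr \<omega> (2 * i) \<ge> 0}"
          by (auto simp: piece_def)
        then show "\<omega> \<in> \<Union> (piece ` Pow {1..r})"
          by (rule UN_I[rotated]) auto
      qed
      fix A assume "A \<in> piece ` Pow {1..r}"
      then obtain S where A: "A = piece S" by blast
      then show "A \<inter> space P \<in> sets P" using piece_sets by auto
      show "(\<lambda>\<omega>. x \<omega> p \<epsilon>) \<in> borel_measurable (restrict_space P A)"
      proof (rule measurable_on_piece_if_determined[OF v_meas])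
        show "A \<subseteq> space P" by (auto simp: A piece_def)
        fix \<omega> assume \<omega>: "\<omega> \<in> A"
        \<comment> \<open>This is the square root of the stability bound for equal starting points,
          with the exponential frozen at \<open>\<omega>\<close>. It involves finitely many
          coordinates of \<open>u\<close>, hence is continuous in the product topology.\<close>
        define h where "h u = sqrt (exp ((2 * (La + (\<Sum>l\<in>I. \<bar>v \<omega> l\<bar> * C * LF)) + 1) * \<epsilon>) *
            ((\<Sum>l\<in>I. \<bar>v \<omega> l - u l\<bar> * C * B)\<^sup>2 * \<epsilon>))" for u
        have "continuous_on UNIV h"
          unfolding h_def by (intro continuous_intros continuous_on_product_coordinates)
        moreover have "h (v \<omega>) = 0" by (simp add: h_def)
        moreover have "dist (x \<omega>' p \<epsilon>) (x \<omega> p \<epsilon>) \<le> h (v \<omega>')" if \<omega>': "\<omega>' \<in> A" for \<omega>'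
        proof -
          have "iota i j (incr \<omega>') = iota i j (incr \<omega>)" if "i \<in> {1..r}" for i j
            using \<omega> \<omega>' that unfolding A piece_def iota_def by auto
          then have \<gamma>_eq: "\<gamma> \<omega>' l = \<gamma> \<omega> l" if "l \<in> I" for l
            using that by (auto simp: \<gamma>_def[abs_def] I_def)
          show ?thesis
            unfolding h_def dist_norm norm_minus_commute[of "x \<omega>' p \<epsilon>"]
            by (rule real_le_rsqrt) (use stability[OF _ _ \<open>p \<in> M\<close> \<open>p \<in> M\<close> \<gamma>_eq] \<omega> \<omega>' A in \<open>auto simp: piece_def\<close>)
        qed
        ultimately show "\<exists>h. continuous_on UNIV h \<and> h (v \<omega>) = 0 \<and>
            (\<forall>\<omega>'\<in>A. dist (x \<omega>' p \<epsilon>) (x \<omega> p \<epsilon>) \<le> h (v \<omega>'))" by blast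
      qed
    qed (simp add: countable_finite)
  qed
  have Z_cont: "continuous_on M (\<lambda>p. x \<omega> p \<epsilon>)" if \<omega>: "\<omega> \<in> space P" for \<omega>
  proof -
    define c where "c = sqrt (exp ((2 * (La + (\<Sum>l\<in>I. \<bar>v \<omega> l\<bar> * C * LF)) + 1) * \<epsilon>))"
    have "c-lipschitz_on M (\<lambda>p. x \<omega> p \<epsilon>)"
    proof (rule lipschitz_onI)
      fix p q assume "p \<in> M" "q \<in> M"
      then have "(norm (x \<omega> p \<epsilon> - x \<omega> q \<epsilon>))\<^sup>2 \<le> (c * norm (p - q))\<^sup>2"
        using stability[OF \<omega> \<omega>, of p q] by (simp add: c_def power_mult_distrib)
      then show "dist (x \<omega> p \<epsilon>) (x \<omega> q \<epsilon>) \<le> c * dist p q"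
        unfolding dist_norm by (rule power2_le_imp_le) (simp add: c_def)
    qed (simp add: c_def)
    then show ?thesis by (rule lipschitz_on_continuous_on)
  qed

  \<comment> \<open>The transition kernel, its Feller property and the invariant measure\<close>
  define K where "K p = distr P borel (\<lambda>\<omega>. x \<omega> p \<epsilon>)" for p
  have [measurable]: "M \<in> sets borel" using \<open>compact M\<close> by (simp add: borel_compact)
  have K: "prob_space (K p)" "sets (K p) = sets borel" "AE y in K p. y \<in> M" if "p \<in> M" for p
  proof -
    show "prob_space (K p)" "sets (K p) = sets borel"
      using Z_meas[OF that] by (auto simp: K_def intro: P.prob_space_distr)
    show "AE y in K p. y \<in> M"
      unfolding K_def using solution(2)[OF _ that] \<open>\<epsilon> > 0\<close>
      by (subst AE_distr_iff[OF Z_meas[OF that]]) auto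
  qed
  have feller: "continuous_on M (\<lambda>p. \<integral>y. h y \<partial>K p)"
    if h: "continuous_on UNIV h" "\<And>y. \<bar>h y\<bar> \<le> 1" for h :: "'a \<Rightarrow> real"
  proof -
    have hm: "h \<in> borel_measurable borel" using h(1) by (rule borel_measurable_continuous_onI)
    have eq: "(\<integral>y. h y \<partial>K p) = (\<integral>\<omega>. h (x \<omega> p \<epsilon>) \<partial>P)" if "p \<in> M" for p
      unfolding K_def by (rule integral_distr[OF Z_meas[OF that] hm])
    show ?thesis
      \<comment> \<open>The Lipschitz constant varies with the path and no uniform bound is at hand,
        so the limit is taken path by path and integrated by dominated convergence, which works
        along sequences.\<close>
      unfolding continuous_on_sequentially
    proof (intro allI ballI impI, elim conjE)
      fix s p assume "p \<in> M" and s: "\<forall>n. s n \<in> M" "s \<longlonglongrightarrow> p"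
      have "(\<lambda>n. \<integral>\<omega>. h (x \<omega> (s n) \<epsilon>) \<partial>P) \<longlonglongrightarrow> (\<integral>\<omega>. h (x \<omega> p \<epsilon>) \<partial>P)"
      proof (rule integral_dominated_convergence[where w = "\<lambda>_. 1"])
        show "(\<lambda>\<omega>. h (x \<omega> p \<epsilon>)) \<in> borel_measurable P"
          by (rule measurable_compose[OF Z_meas[OF \<open>p \<in> M\<close>] hm])
        show "(\<lambda>\<omega>. h (x \<omega> (s n) \<epsilon>)) \<in> borel_measurable P" for n
          by (rule measurable_compose[OF Z_meas hm]) (use s in auto)
        have "(\<lambda>n. h (x \<omega> (s n) \<epsilon>)) \<longlonglongrightarrow> h (x \<omega> p \<epsilon>)" if "\<omega> \<in> space P" for \<omega>
        proof -
          have "(\<lambda>n. x \<omega> (s n) \<epsilon>) \<longlonglongrightarrow> x \<omega> p \<epsilon>"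
            using Z_cont[OF that] \<open>p \<in> M\<close> s unfolding continuous_on_sequentially o_def by blast
          then show ?thesis
            using h(1) unfolding continuous_on_sequentially o_def by blast
        qed
        then show "AE \<omega> in P. (\<lambda>n. h (x \<omega> (s n) \<epsilon>)) \<longlonglongrightarrow> h (x \<omega> p \<epsilon>)" by simp
      qed (use h in auto)
      then show "((\<lambda>p. \<integral>y. h y \<partial>K p) \<circ> s) \<longlonglongrightarrow> (\<integral>y. h y \<partial>K p)"
        using s \<open>p \<in> M\<close> by (simp add: o_def eq)
    qed
  qed
  obtain \<pi> where \<pi>: "prob_space \<pi>" "sets \<pi> = sets borel" "AE y in \<pi>. y \<in> M"
    and inv: "\<forall>A\<in>sets borel. (\<integral>\<^sup>+p. emeasure (K p) A * indicator M p \<partial>\<pi>) = emeasure \<pi> A"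
    by (rule krylov_bogoliubov_compact[OF \<open>compact M\<close> \<open>M \<noteq> {}\<close> K feller])
  interpret \<pi>: prob_space \<pi> by fact
  have [simp]: "M \<in> sets \<pi>" using \<pi>(2) by simp
  show ?thesis
  \<comment> \<open>\<open>\<pi>\<close> has full mass on \<open>M\<close>, so its restriction is
    still a probability measure. Integrals over the restriction are integrals weighted by
    \<open>indicator M\<close>, and on \<open>M\<close> the sampled kernel agrees with
    \<open>K\<close>.\<close>
  proof (intro exI[of _ "restrict_space \<pi> M"] conjI ballI)
    show "prob_space (restrict_space \<pi> M)"
      using prob_space_restrict_space[OF \<open>M \<in> sets \<pi>\<close>] \<pi>.emeasure_eq_1_AE[OF \<open>M \<in> sets \<pi>\<close> \<pi>(3)] by simp
    show "sets (restrict_space \<pi> M) = sets (restrict_space borel M)"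
      using \<pi>(2) by (rule sets_restrict_space_cong)
    fix A assume "A \<in> sets (restrict_space borel M)"
    then have A: "A \<in> sets borel" "A \<subseteq> M" by (auto simp: sets_restrict_space_iff)
    have kernel: "sampled_kernel P \<epsilon> x p A = emeasure (K p) A" if "p \<in> M" for p
      unfolding sampled_kernel_def K_def
      by (simp add: emeasure_distr[OF Z_meas[OF that] A(1)] vimage_def Int_def conj_commute)
    have "(\<integral>\<^sup>+ p. sampled_kernel P \<epsilon> x p A \<partial>restrict_space \<pi> M) =
        (\<integral>\<^sup>+ p. sampled_kernel P \<epsilon> x p A * indicator M p \<partial>\<pi>)"
      by (rule nn_integral_restrict_space) simp
    also have "\<dots> = (\<integral>\<^sup>+p. emeasure (K p) A * indicator M p \<partial>\<pi>)"
      by (rule nn_integral_cong) (simp add: kernel indicator_def)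
    also have "\<dots> = emeasure (restrict_space \<pi> M) A"
      using inv A by (simp add: emeasure_restrict_space)
    finally show "(\<integral>\<^sup>+ p. sampled_kernel P \<epsilon> x p A \<partial>restrict_space \<pi> M) = emeasure (restrict_space \<pi> M) A" .
  qed
qed

end
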